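(* Let $D=2$ and $0<\alpha\le 2$. For the caching broadcast channel with a wire and cache tapping adversary of type II (CBC-WCT II) described in the context, the strong secrecy capacity is $$C_s(\alpha)=1-\frac{\alpha}{2}.$$
   Context: The caching broadcast channel with a wire and cache tapping adversary of type II (CBC-WCT II) is defined as follows. Fix an integer $D\ge 2$ (library size), a block length $n$, and a tapping fraction $\alpha\in(0,2]$; put $\mu=\alpha n$ (assumed to be an integer, or rounded). A transmitter holds $D$ mutually independent files $W_1,\dots,W_D$, each uniform on $[1:2^{nR_s}]$, and has access to private randomness independent of the files. There are two receivers, each with a cache memory of $n/2$ bits. Communication takes place in two phases over a noiseless binary broadcast channel. (i) Cache placement: without knowledge of future demands, the transmitter sends $\mathbf X_c^n\in\{0,1\}^n$, a (possibly randomized) function of $W_{[1:D]}$; receiver $j\in\{1,2\}$ stores $M_{c,j}=f_{c,j}(\mathbf X_c^n)\in[1:2^{n/2}]$. (ii) Delivery: the receivers reveal a demand vector $\mathbf d=(d_1,d_2)\in[1:D]^2$; the transmitter sends $\mathbf X_{\mathbf d}^n\in\{0,1\}^n$, a (possibly randomized) function of $W_{[1:D]}$ and $\mathbf d$ (it may use the same private randomness as in placement). Receiver $j$ outputs $\hat W_{d_j}=g_{\mathbf d,j}(M_{c,j},\mathbf X_{\mathbf d}^n)$. Adversary: it chooses subsets $S_1,S_2\subseteq[1:n]$ with $|S_1|+|S_2|\le\mu$ (unknown to the legitimate parties, who know only $\mu$), and observes $\mathbf Z_{S_1}^n,\mathbf Z_{S_2}^n\in\{0,1,?\}^n$ where $Z_{S_1,i}=X_{c,i}$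 if $i\in S_1$ and $Z_{S_1,i}=?$ (erasure) otherwise, and $Z_{S_2,i}=X_{\mathbf d,i}$ if $i\in S_2$ and $?$ otherwise. A file rate $R_s$ is achievable with strong secrecy if there is a sequence of such codes (indexed by $n$) with $\lim_{n\to\infty}\max_{\mathbf d\in[1:D]^2}\Pr\big(\bigcup_{j=1,2}\{\hat W_{d_j}\neq W_{d_j}\}\big)=0$ and $\lim_{n\to\infty}\max_{S_1,S_2\subseteq[1:n]:|S_1|+|S_2|\le\mu} I(W_{[1:D]};\mathbf Z_{S_1}^n,\mathbf Z_{S_2}^n)=0$. The strong secrecy capacity $C_s(\alpha)$ is the supremum of achievable $R_s$. *)

theory Defs
  imports "HOL-Probability.Probability"
begin

text \<open>Caching broadcast channel with a wire and cache tapping adversary of type II.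
  Conventions: bits/indices are 0-based; files are indexed 0..D-1, receivers 0,1.
  Files W_{[1:D]} are a list ws of length D with entries in {0..<K}, K = ceil(2^(nR)).
  All private randomness of the transmitter is a single random variable u drawn from
  the pmf rnd (independent of the files), shared by placement and delivery.\<close>

record cbc_code =
  rnd   :: "nat pmf"
  plc   :: "nat list \<Rightarrow> nat \<Rightarrow> bool list"              \<comment> \<open>placement X_c = plc W u\<close>
  cch   :: "nat \<Rightarrow> bool list \<Rightarrow> nat"                   \<comment> \<open>cache function f_{c,j}\<close>
  dlv   :: "nat \<times> nat \<Rightarrow> nat list \<Rightarrow> nat \<Rightarrow> bool list"   \<comment> \<open>delivery X_d = dlv d W u\<close>
  dec   :: "nat \<times> nat \<Rightarrow> nat \<Rightarrow> nat \<Rightarrow> bool list \<Rightarrow> nat" \<comment> \<open>decoder g_{d,j}(M_{c,j}, X_d)\<close>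

definition num_msgs :: "nat \<Rightarrow> real \<Rightarrow> nat" where
  "num_msgs n R = nat \<lceil>2 powr (real n * R)\<rceil>"

definition cache_size :: "nat \<Rightarrow> nat" where
  "cache_size n = nat \<lfloor>2 powr (real n / 2)\<rfloor>"

definition file_set :: "nat \<Rightarrow> nat \<Rightarrow> real \<Rightarrow> nat list set" where
  "file_set D n R = {ws. length ws = D \<and> (\<forall>w\<in>set ws. w < num_msgs n R)}"

definition demands :: "nat \<Rightarrow> (nat \<times> nat) set" where
  "demands D = {..<D} \<times> {..<D}"

definition valid_code :: "nat \<Rightarrow> nat \<Rightarrow> real \<Rightarrow> cbc_code \<Rightarrow> bool" where
  "valid_code D n R c \<longleftrightarrow>
     (\<forall>ws\<in>file_set D n R. \<forall>u\<in>set_pmf (rnd c).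
        length (plc c ws u) = n \<and> (\<forall>d\<in>demands D. length (dlv c d ws u) = n)) \<and>
     (\<forall>j<2. \<forall>x. length x = n \<longrightarrow> cch c j x < cache_size n)"

definition joint :: "nat \<Rightarrow> nat \<Rightarrow> real \<Rightarrow> cbc_code \<Rightarrow> (nat list \<times> nat) pmf" where
  "joint D n R c = pair_pmf (pmf_of_set (file_set D n R)) (rnd c)"

text \<open>Erasure observation Z_S of an n-bit string x (None = erasure).\<close>
definition tap :: "nat \<Rightarrow> nat set \<Rightarrow> bool list \<Rightarrow> bool option list" where
  "tap n S x = map (\<lambda>i. if i \<in> S then Some (x ! i) else None) [0..<n]"

definition err_prob :: "nat \<Rightarrow> nat \<Rightarrow> real \<Rightarrow> cbc_code \<Rightarrow> nat \<times> nat \<Rightarrow> real" where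
  "err_prob D n R c d = measure_pmf.prob (joint D n R c)
     {(ws, u). dec c d 0 (cch c 0 (plc c ws u)) (dlv c d ws u) \<noteq> ws ! fst d \<or>
               dec c d 1 (cch c 1 (plc c ws u)) (dlv c d ws u) \<noteq> ws ! snd d}"

definition tap_sets :: "nat \<Rightarrow> real \<Rightarrow> (nat set \<times> nat set) set" where
  "tap_sets n \<alpha> = {(S1, S2). S1 \<subseteq> {..<n} \<and> S2 \<subseteq> {..<n} \<and> real (card S1 + card S2) \<le> \<alpha> * real n}"

definition leakage :: "nat \<Rightarrow> nat \<Rightarrow> real \<Rightarrow> cbc_code \<Rightarrow> nat \<times> nat \<Rightarrow> nat set \<Rightarrow> nat set \<Rightarrow> real" where
  "leakage D n R c d S1 S2 =
     prob_space.mutual_information (measure_pmf (joint D n R c)) 2 (count_space UNIV) (count_space UNIV)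
       fst (\<lambda>(ws, u). (tap n S1 (plc c ws u), tap n S2 (dlv c d ws u)))"

definition max_err :: "nat \<Rightarrow> nat \<Rightarrow> real \<Rightarrow> cbc_code \<Rightarrow> real" where
  "max_err D n R c = Max (err_prob D n R c ` demands D)"

text \<open>The adversary chooses the tapping sets knowing the demand vector, hence the maximum
  is also over demands.\<close>
definition max_leak :: "nat \<Rightarrow> nat \<Rightarrow> real \<Rightarrow> real \<Rightarrow> cbc_code \<Rightarrow> real" where
  "max_leak D n R \<alpha> c = Max ((\<lambda>(d, S1, S2). leakage D n R c d S1 S2) ` (demands D \<times> tap_sets n \<alpha>))"

definition achievable :: "nat \<Rightarrow> real \<Rightarrow> real \<Rightarrow> bool" where
  "achievable D \<alpha> R \<longleftrightarrow> (\<exists>codes :: nat \<Rightarrow> cbc_code.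
      (\<forall>n. valid_code D n R (codes n)) \<and>
      (\<lambda>n. max_err D n R (codes n)) \<longlonglongrightarrow> 0 \<and>
      (\<lambda>n. max_leak D n R \<alpha> (codes n)) \<longlonglongrightarrow> 0)"

definition secrecy_capacity :: "nat \<Rightarrow> real \<Rightarrow> real" where
  "secrecy_capacity D \<alpha> = Sup {R. achievable D \<alpha> R}"

end

theory Submission
  imports Defs "HOL-Real_Asymp.Real_Asymp"
begin

text \<open>
  Converse: for the demand \<open>(0, 1)\<close> the two transmitted words determine both files, and once
  \<open>\<alpha> n\<close> of their \<open>2 n\<close> bits are known at most \<open>2\<^bsup>(2 - \<alpha>) n\<^esup>\<close> pairs of files remain decodable. If
  \<open>2 R > 2 - \<alpha>\<close>, this set has vanishing probability under the product law of files and observation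
  but probability near 1 under the joint law, so the mutual information stays bounded away from 0.

  Achievability: a file is split into parts \<open>p\<^sub>1, p\<^sub>2 < g\<close> and \<open>p\<^sub>3 < q\<close>. Parts 1 and 2 are handled
  by coded caching (the sums \<open>A\<^sub>1 + B\<^sub>1\<close>, \<open>A\<^sub>2 + B\<^sub>2\<close> are cached and \<open>W\<^sub>1\<close> of the second and \<open>W\<^sub>2\<close> of
  the first demanded file are delivered), part 3 by one-time pads with two keys from the caches. The
  resulting label is not sent itself: with two random functions \<open>h, k\<close> from words to labels,
  the transmitter sends a uniformly chosen word with the required label, so decoding is error-free.
  For fixed files, the probability of an observation is a sum over the keys of products of relative
  bin sizes inside two subcubes; by Chernoff bounds with doubly exponentially small failure
  probability it exceeds the uniform value by a factor close to 1 at most, simultaneously for all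
  files, demands, tapping sets and observations.
\<close>

section \<open>Mutual information of discrete random variables\<close>

lemma distributed_measure_pmf:
  fixes X :: "'a \<Rightarrow> 'b::countable"
  shows "distributed (measure_pmf J) (count_space UNIV) X (\<lambda>x. ennreal (pmf (map_pmf X J) x))"
  unfolding distributed_def
  by (auto simp: map_pmf_rep_eq[symmetric] measure_pmf_eq_density[symmetric])

text \<open>Countable types make the product of the two counting measures a counting measure, and
  the finite support of the joint law then turns the integral of densities into a finite
  sum.\<close>

lemma mutual_information_pmf:
  fixes X :: "'a \<Rightarrow> 'b::countable" and Y :: "'a \<Rightarrow> 'c::countable"
  defines "P \<equiv> \<lambda>J. map_pmf (\<lambda>a. (X a, Y a)) J"
  assumes fin: "finite (set_pmf (P J))"
  shows "prob_space.mutual_information (measure_pmf J) 2 (count_space UNIV) (count_space UNIV) X Y =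
    (\<Sum>z\<in>set_pmf (P J). pmf (P J) z *
       log 2 (pmf (P J) z / (pmf (map_pmf X J) (fst z) * pmf (map_pmf Y J) (snd z))))"
proof -
  interpret information_space "measure_pmf J" 2
    by unfold_locales auto
  have pc: "count_space UNIV \<Otimes>\<^sub>M count_space UNIV = (count_space UNIV :: ('b \<times> 'c) measure)"
    by (simp add: pair_measure_countable)
  have "prob_space.mutual_information (measure_pmf J) 2 (count_space UNIV) (count_space UNIV) X Y =
    integral\<^sup>L (count_space UNIV \<Otimes>\<^sub>M count_space UNIV)
     (\<lambda>z. pmf (P J) z * log 2 (pmf (P J) z / (pmf (map_pmf X J) (fst z) * pmf (map_pmf Y J) (snd z))))"
    by (rule mutual_information_distr)
       (auto intro!: distributed_measure_pmf sigma_finite_measure_count_space_countable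
         simp: pc P_def)
  also have "\<dots> = (\<Sum>z | z \<in> UNIV \<and> pmf (P J) z * log 2 (pmf (P J) z / (pmf (map_pmf X J) (fst z) * pmf (map_pmf Y J) (snd z))) \<noteq> 0.
       pmf (P J) z * log 2 (pmf (P J) z / (pmf (map_pmf X J) (fst z) * pmf (map_pmf Y J) (snd z))))"
    unfolding pc
    by (rule lebesgue_integral_count_space_finite_support)
       (rule finite_subset[OF _ fin], auto simp: set_pmf_iff)
  also have "\<dots> = (\<Sum>z\<in>set_pmf (P J). pmf (P J) z *
       log 2 (pmf (P J) z / (pmf (map_pmf X J) (fst z) * pmf (map_pmf Y J) (snd z))))"
    by (rule sum.mono_neutral_left) (use fin in \<open>auto simp: set_pmf_iff\<close>)
  finally show ?thesis .
qed

text \<open>The product law is tilted by the exponential of the indicator of \<open>E\<close>; the only analytic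
  input is \<open>ln t \<ge> 1 - 1 / t\<close>.\<close>

lemma mutual_information_pmf_ge:
  fixes X :: "'a \<Rightarrow> 'b::countable" and Y :: "'a \<Rightarrow> 'c::countable"
  defines "P \<equiv> \<lambda>J. map_pmf (\<lambda>a. (X a, Y a)) J"
  assumes fin: "finite (set_pmf (P J))"
  shows "ln 2 * prob_space.mutual_information (measure_pmf J) 2 (count_space UNIV) (count_space UNIV) X Y
     \<ge> measure_pmf.prob (P J) E - 2 * measure_pmf.prob (pair_pmf (map_pmf X J) (map_pmf Y J)) E"
proof -
  define p where "p = pmf (P J)"
  define q where "q = pmf (pair_pmf (map_pmf X J) (map_pmf Y J))"
  define A where "A = set_pmf (P J)"
  let ?Q = "pair_pmf (map_pmf X J) (map_pmf Y J)"
  have A: "finite A" using fin by (simp add: A_def)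
  have q_eq: "q z = pmf (map_pmf X J) (fst z) * pmf (map_pmf Y J) (snd z)" for z
    unfolding q_def by (cases z) (simp add: pmf_pair)
  have ppos: "p z > 0" if "z \<in> A" for z
    using that by (simp add: p_def A_def pmf_positive)
  have sub: "A \<subseteq> set_pmf ?Q"
    by (auto simp: A_def P_def)
  have qpos: "q z > 0" if "z \<in> A" for z
    using that sub unfolding q_def by (intro pmf_positive) auto
  have "(\<Sum>z\<in>A. p z * indicat_real E z) + 1 - (\<Sum>z\<in>A. q z * (1 + 2 * indicat_real E z))
     = (\<Sum>z\<in>A. p z * (indicat_real E z + 1) - q z * (1 + 2 * indicat_real E z))"
    using sum_pmf_eq_1[OF A, of "P J"] unfolding p_def A_def
    by (simp add: sum.distrib sum_subtractf distrib_left)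
  also have "\<dots> \<le> (\<Sum>z\<in>A. p z * ln (p z / q z))"
  proof (rule sum_mono)
    fix z assume z: "z \<in> A"
    define g where "g = indicat_real E z"
    \<comment> \<open>\<open>g\<close> only takes the values 0 and 1, and
      \<open>exp 1 \<le> 3\<close>; this is the source of the factor 2 in front of the product
      law.\<close>
    have e: "exp g \<le> 1 + 2 * g"
      using exp_le by (auto simp: g_def indicator_def)
    have "ln (q z * exp g / p z) \<le> q z * exp g / p z - 1"
      using ppos[OF z] qpos[OF z] by (intro ln_le_minus_one) auto
    moreover have "ln (q z * exp g / p z) = g - ln (p z / q z)"
      using ppos[OF z] qpos[OF z] by (simp add: ln_mult ln_div)
    ultimately have "g + 1 - q z * exp g / p z \<le> ln (p z / q z)" by simp
    then have "p z * (g + 1 - q z * exp g / p z) \<le> p z * ln (p z / q z)"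
      using ppos[OF z] by (intro mult_left_mono) auto
    moreover have "p z * (g + 1 - q z * exp g / p z) = p z * (g + 1) - q z * exp g"
      using ppos[OF z] by (simp add: field_simps)
    moreover have "q z * exp g \<le> q z * (1 + 2 * g)"
      using qpos[OF z] e by (intro mult_left_mono) auto
    ultimately show "p z * (g + 1) - q z * (1 + 2 * g) \<le> p z * ln (p z / q z)"
      by linarith
  qed
  also have "\<dots> = ln 2 * prob_space.mutual_information (measure_pmf J) 2 (count_space UNIV) (count_space UNIV) X Y"
    using fin unfolding P_def p_def A_def
    by (subst mutual_information_pmf) (auto simp: q_eq log_def sum_distrib_left P_def intro!: sum.cong)
  finally have main: "(\<Sum>z\<in>A. p z * indicat_real E z) + 1 - (\<Sum>z\<in>A. q z * (1 + 2 * indicat_real E z)) \<le> \<dots>" .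
  have pE: "(\<Sum>z\<in>A. p z * indicat_real E z) = measure_pmf.prob (P J) E"
  proof -
    have "(\<Sum>z\<in>A. p z * indicat_real E z) = (\<Sum>z\<in>A \<inter> E. p z)"
      using A by (simp add: sum.inter_restrict indicator_def if_distrib cong: if_cong)
    also have "\<dots> = measure_pmf.prob (P J) (A \<inter> E)"
      unfolding p_def using A by (simp add: measure_measure_pmf_finite)
    also have "\<dots> = measure_pmf.prob (P J) E"
      by (metis A_def Int_commute measure_Int_set_pmf)
    finally show ?thesis .
  qed
  have "(\<Sum>z\<in>A. q z * (1 + 2 * indicat_real E z)) = (\<Sum>z\<in>A. q z) + 2 * (\<Sum>z\<in>A. q z * indicat_real E z)"
    by (simp add: sum.distrib distrib_left sum_distrib_left mult.left_commute)
  also have "(\<Sum>z\<in>A. q z) = measure_pmf.prob ?Q A"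
    unfolding q_def using A by (simp add: measure_measure_pmf_finite)
  also have "(\<Sum>z\<in>A. q z * indicat_real E z) = (\<Sum>z\<in>A \<inter> E. q z)"
      using A by (simp add: sum.inter_restrict indicator_def if_distrib cong: if_cong)
  also have "(\<Sum>z\<in>A \<inter> E. q z) = measure_pmf.prob ?Q (A \<inter> E)"
      unfolding q_def using A by (simp add: measure_measure_pmf_finite)
  \<comment> \<open>\<open>A\<close> supports the joint law, while the product law may have mass
    outside it, so only an inequality is available here.\<close>
  also have "measure_pmf.prob ?Q A + 2 * measure_pmf.prob ?Q (A \<inter> E) \<le> 1 + 2 * measure_pmf.prob ?Q E"
    by (intro add_mono mult_left_mono measure_pmf.finite_measure_mono) auto
  finally show ?thesis using main pE by linarith
qed

text \<open>The tilted bound with the empty event, which has mass 0 under both laws.\<close>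

lemma mutual_information_pmf_nonneg:
  fixes X :: "'a \<Rightarrow> 'b::countable" and Y :: "'a \<Rightarrow> 'c::countable"
  assumes fin: "finite (set_pmf (map_pmf (\<lambda>a. (X a, Y a)) J))"
  shows "prob_space.mutual_information (measure_pmf J) 2 (count_space UNIV) (count_space UNIV) X Y \<ge> 0"
  using mutual_information_pmf_ge[OF fin, of "{}"] by (simp add: zero_le_mult_iff)

text \<open>If, given any value of \<open>X\<close>, the law of \<open>Y\<close> is at most \<beta>
  times the uniform law on \<open>B\<close>, the logarithm of the density ratio is at most
  \<open>ln \<beta> + ln (1 / (N * py y))\<close>. The second term averages to minus the divergence
  of \<open>Y\<close> from uniform, hence to at most 0; the proof gets this from
  \<open>ln t \<le> t - 1\<close>.\<close>

lemma mutual_information_pmf_le: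
  fixes X :: "'a \<Rightarrow> 'b::countable" and Y :: "'a \<Rightarrow> 'c::countable"
  defines "P \<equiv> \<lambda>J. map_pmf (\<lambda>a. (X a, Y a)) J"
  assumes fin: "finite (set_pmf (P J))"
    and B: "finite B" "set_pmf (map_pmf Y J) \<subseteq> B"
    and \<beta>: "\<beta> > 0"
    and bound: "\<And>x y. (x, y) \<in> set_pmf (P J) \<Longrightarrow>
      pmf (P J) (x, y) \<le> \<beta> / real (card B) * pmf (map_pmf X J) x"
  shows "prob_space.mutual_information (measure_pmf J) 2 (count_space UNIV) (count_space UNIV) X Y
     \<le> log 2 \<beta>"
proof -
  define A where "A = set_pmf (P J)"
  define px where "px = pmf (map_pmf X J)"
  define py where "py = pmf (map_pmf Y J)"
  define p where "p = pmf (P J)"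
  have A: "finite A" using fin by (simp add: A_def)
  define N where "N = real (card B)"
  have "B \<noteq> {}" using B set_pmf_not_empty by (metis subset_empty)
  then have N: "N > 0" using B by (auto simp: N_def card_gt_0_iff)
  have "ln 2 * prob_space.mutual_information (measure_pmf J) 2 (count_space UNIV) (count_space UNIV) X Y
    = (\<Sum>z\<in>A. p z * ln (p z / (px (fst z) * py (snd z))))"
    using fin unfolding P_def p_def A_def px_def py_def
    by (subst mutual_information_pmf) (auto simp: log_def sum_distrib_left P_def intro!: sum.cong)
  also have "\<dots> \<le> (\<Sum>z\<in>A. p z * (ln \<beta> + (1 / (N * py (snd z)) - 1)))"
  proof (rule sum_mono)
    fix z assume z: "z \<in> A"
    obtain x y where xy: "z = (x, y)" by (cases z)
    have pos: "p z > 0" "px x > 0" "py y > 0"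
      using z unfolding xy p_def px_def py_def A_def P_def
      by (auto intro!: pmf_positive)
    have "p z \<le> \<beta> / N * px x"
      using bound[of x y] z by (simp add: p_def px_def xy A_def N_def)
    then have "p z / (px x * py y) \<le> \<beta> * (1 / (N * py y))"
      using pos N by (simp add: field_simps)
    then have "ln (p z / (px x * py y)) \<le> ln (\<beta> * (1 / (N * py y)))"
      using pos N \<beta> by (subst ln_le_cancel_iff) auto
    also have "\<dots> = ln \<beta> + ln (1 / (N * py y))"
      using pos N \<beta> by (subst ln_mult) auto
    also have "\<dots> \<le> ln \<beta> + (1 / (N * py y) - 1)"
      using pos N by (intro add_left_mono ln_le_minus_one) auto
    finally show "p z * ln (p z / (px (fst z) * py (snd z))) \<le> p z * (ln \<beta> + (1 / (N * py (snd z)) - 1))"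
      using pos by (simp add: xy)
  qed
  also have "\<dots> = ln \<beta> + (\<Sum>z\<in>A. p z * (1 / (N * py (snd z)))) - 1"
    using sum_pmf_eq_1[OF A, of "P J"]
    by (simp add: distrib_left right_diff_distrib sum.distrib sum_subtractf p_def A_def
        flip: sum_distrib_right)
  also have "(\<Sum>z\<in>A. p z * (1 / (N * py (snd z)))) = measure_pmf.expectation (P J) (\<lambda>z. 1 / (N * py (snd z)))"
    using A by (subst integral_measure_pmf_real[of A]) (auto simp: A_def p_def set_pmf_iff mult.commute)
  also have "\<dots> = measure_pmf.expectation (map_pmf Y J) (\<lambda>y. 1 / (N * py y))"
    by (simp add: P_def)
  also have "\<dots> = (\<Sum>y\<in>B. 1 / (N * py y) * py y)"
    using B by (subst integral_measure_pmf_real[of B]) (auto simp: py_def)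
  \<comment> \<open>Where \<open>py y = 0\<close>, division by zero makes the term 0 instead of
    \<open>1 / N\<close>.\<close>
  also have "\<dots> \<le> (\<Sum>y\<in>B. 1 / N)"
    using N by (intro sum_mono) (auto simp: field_simps)
  also have "\<dots> = 1"
    using N by (simp add: N_def)
  finally have "ln 2 * prob_space.mutual_information (measure_pmf J) 2 (count_space UNIV) (count_space UNIV) X Y \<le> ln \<beta>"
    by simp
  then show ?thesis
    by (simp add: log_def field_simps)
qed

section \<open>Converse\<close>

definition words :: "nat \<Rightarrow> bool list set" where
  "words n = {x. length x = n}"

lemma words_eq_lists: "words n = {x. set x \<subseteq> UNIV \<and> length x = n}"
  by (auto simp: words_def)

lemma finite_words [simp]: "finite (words n)"
  unfolding words_eq_lists by (rule finite_lists_length_eq) simp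

lemma card_words: "card (words n) = 2 ^ n"
  unfolding words_eq_lists by (subst card_lists_length_eq) auto

lemma tap_eq_iff: "tap n S x = tap n S y \<longleftrightarrow> (\<forall>i\<in>{..<n} \<inter> S. x ! i = y ! i)"
  unfolding tap_def by auto

text \<open>Outside \<open>S\<close> the bits are free, so the words agreeing with \<open>y\<close>
  on \<open>S\<close> correspond to subsets of \<open>{..<n} - S\<close>, namely the positions there
  that hold \<open>True\<close>.\<close>

lemma card_tap_fibre:
  assumes "S \<subseteq> {..<n}"
  shows "card {x \<in> words n. tap n S x = tap n S y} = 2 ^ (n - card S)"
proof -
  have bij: "bij_betw (\<lambda>T. map (\<lambda>i. if i \<in> S then y ! i else i \<in> T) [0..<n]) (Pow ({..<n} - S))
     {x \<in> words n. tap n S x = tap n S y}"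
  proof (rule bij_betw_byWitness[where f' = "\<lambda>x. {i \<in> {..<n} - S. x ! i}"])
    show "\<forall>x\<in>{x \<in> words n. tap n S x = tap n S y}.
        map (\<lambda>i. if i \<in> S then y ! i else i \<in> {i \<in> {..<n} - S. x ! i}) [0..<n] = x"
      by (auto simp: words_def tap_eq_iff intro!: nth_equalityI)
  qed (auto simp: words_def tap_eq_iff)
  then have "card {x \<in> words n. tap n S x = tap n S y} = card (Pow ({..<n} - S))"
    using bij_betw_same_card[OF bij] by simp
  also have "\<dots> = 2 ^ (n - card S)"
    using assms by (simp add: card_Pow card_Diff_subset finite_subset)
  finally show ?thesis .
qed

text \<open>Double counting of the words: all nonempty fibres of the observation have the same
  size.\<close>

lemma card_tap_image:
  assumes "S \<subseteq> {..<n}"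
  shows "card (tap n S ` words n) = 2 ^ card S"
proof -
  have "card S \<le> n" using card_mono[OF _ assms] by simp
  have "2 ^ n = (\<Sum>z\<in>tap n S ` words n. card {x \<in> words n. tap n S x = z})"
    using sum.image_gen[of "words n" "\<lambda>_. 1::nat" "tap n S"] by (simp add: card_words)
  also have "\<dots> = card (tap n S ` words n) * 2 ^ (n - card S)"
    using card_tap_fibre[OF assms] by (subst sum.cong[OF refl, of _ _ "\<lambda>_. 2 ^ (n - card S)"]) auto
  also have "(2::nat) ^ n = 2 ^ card S * 2 ^ (n - card S)"
    using \<open>card S \<le> n\<close> by (simp flip: power_add)
  finally show ?thesis by simp
qed

lemma num_msgs_pos [simp]: "num_msgs n R > 0"
  unfolding num_msgs_def by (simp add: powr_def)

lemma num_msgs_ge: "2 powr (real n * R) \<le> real (num_msgs n R)"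
  unfolding num_msgs_def by linarith

lemma num_msgs_le: "real (num_msgs n R) \<le> 2 powr (real n * R) + 1"
proof -
  have "2 powr (real n * R) \<ge> 0" by simp
  then show ?thesis unfolding num_msgs_def by linarith
qed

lemma file_set_eq_lists: "file_set D n R = {ws. set ws \<subseteq> {..<num_msgs n R} \<and> length ws = D}"
  by (auto simp: file_set_def)

lemma finite_file_set [simp]: "finite (file_set D n R)"
  unfolding file_set_eq_lists by (rule finite_lists_length_eq) simp

lemma card_file_set: "card (file_set D n R) = num_msgs n R ^ D"
  unfolding file_set_eq_lists by (subst card_lists_length_eq) auto

lemma file_set_nonempty [simp]: "file_set D n R \<noteq> {}"
  using card_file_set[of D n R] by (metis card.empty num_msgs_pos power_eq_0_iff less_irrefl)

section \<open>Leakage as a mutual information with finite support\<close>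

definition taps :: "nat \<Rightarrow> cbc_code \<Rightarrow> nat \<times> nat \<Rightarrow> nat set \<Rightarrow> nat set \<Rightarrow> nat list \<times> nat \<Rightarrow> bool option list \<times> bool option list" where
  "taps n c d S1 S2 = (\<lambda>(ws, u). (tap n S1 (plc c ws u), tap n S2 (dlv c d ws u)))"

lemma leakage_eq_taps:
  "leakage D n R c d S1 S2 =
     prob_space.mutual_information (measure_pmf (joint D n R c)) 2 (count_space UNIV) (count_space UNIV)
       fst (taps n c d S1 S2)"
  by (simp add: leakage_def taps_def)

lemma set_joint: "set_pmf (joint D n R c) = file_set D n R \<times> set_pmf (rnd c)"
  by (simp add: joint_def set_pmf_of_set)

lemma map_fst_joint: "map_pmf fst (joint D n R c) = pmf_of_set (file_set D n R)"
  by (simp add: joint_def map_fst_pair_pmf)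

text \<open>The private randomness may have infinite support, but the observations are lists of
  fixed length \<open>n\<close> over a finite type.\<close>

lemma finite_leakage_support:
  "finite (set_pmf (map_pmf (\<lambda>a. (fst a, taps n c d S1 S2 a)) (joint D n R c)))"
proof (rule finite_subset)
  let ?L = "{z :: bool option list. set z \<subseteq> UNIV \<and> length z = n}"
  show "set_pmf (map_pmf (\<lambda>a. (fst a, taps n c d S1 S2 a)) (joint D n R c)) \<subseteq> file_set D n R \<times> (?L \<times> ?L)"
    by (auto simp: set_joint taps_def tap_def)
  show "finite (file_set D n R \<times> (?L \<times> ?L))"
    by (intro finite_cartesian_product finite_lists_length_eq) simp_all
qed

lemma leakage_nonneg: "leakage D n R c d S1 S2 \<ge> 0"
  unfolding leakage_eq_taps
  by (rule mutual_information_pmf_nonneg[OF finite_leakage_support])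

text \<open>Conditioning on the second component. For the product law of files and observation this
  means fixing the observation and counting the files that remain possible.\<close>

lemma prob_pair_pmf_le:
  assumes "\<And>y. y \<in> set_pmf B \<Longrightarrow> measure_pmf.prob A {x. (x, y) \<in> E} \<le> t" "t \<ge> 0"
  shows "measure_pmf.prob (pair_pmf A B) E \<le> t"
proof -
  have "pair_pmf A B = bind_pmf B (\<lambda>y. map_pmf (\<lambda>x. (x, y)) A)"
    unfolding pair_pmf_def map_pmf_def by (rule bind_commute_pmf)
  then have "emeasure (measure_pmf (pair_pmf A B)) E = (\<integral>\<^sup>+y. emeasure (map_pmf (\<lambda>x. (x, y)) A) E \<partial>B)"
    by simp
  also have "\<dots> \<le> (\<integral>\<^sup>+y. ennreal t \<partial>B)"
    by (intro nn_integral_mono_AE)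
       (use assms in \<open>auto simp: AE_measure_pmf_iff measure_pmf.emeasure_eq_measure vimage_def intro!: ennreal_leI\<close>)
  also have "\<dots> = ennreal t" by (simp add: measure_pmf.emeasure_space_1)
  finally show ?thesis
    using assms(2) by (simp add: measure_pmf.emeasure_eq_measure)
qed

text \<open>For the demand \<open>(0, 1)\<close> the receivers together recover both files. Let
  \<open>E\<close> be the event that the files are decoded from some pair of words consistent with
  the observation. Its joint probability is at least one minus the error, whereas under the product
  law an observation leaves at most as many candidates as it has consistent pairs of words, out of
  \<open>num_msgs n R ^ 2\<close> equally likely ones.\<close>

lemma leakage_lower_bound:
  assumes valid: "valid_code 2 n R c" and S: "S1 \<subseteq> {..<n}" "S2 \<subseteq> {..<n}"
  shows "1 - err_prob 2 n R c (0, 1) - 2 * (2 ^ (n - card S1 + (n - card S2)) / real (num_msgs n R) ^ 2)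
    \<le> ln 2 * leakage 2 n R c (0, 1) S1 S2"
proof -
  define J where "J = joint 2 n R c"
  define Y where "Y = taps n c (0, 1) S1 S2"
  \<comment> \<open>The caches are functions of the placement word, so the two transmitted words
    alone determine both decoder outputs.\<close>
  define D where "D = (\<lambda>x y. [dec c (0, 1) 0 (cch c 0 x) y, dec c (0, 1) 1 (cch c 1 x) y])"
  define fib where "fib = (\<lambda>z. {x \<in> words n. tap n S1 x = fst z} \<times> {y \<in> words n. tap n S2 y = snd z})"
  define E where "E = {(ws, z). ws \<in> case_prod D ` fib z}"
  define err where "err = {(ws, u). dec c (0, 1) 0 (cch c 0 (plc c ws u)) (dlv c (0, 1) ws u) \<noteq> ws ! fst (0::nat, 1::nat) \<or>
               dec c (0, 1) 1 (cch c 1 (plc c ws u)) (dlv c (0, 1) ws u) \<noteq> ws ! snd (0::nat, 1::nat)}"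
  have card_fib: "card (fib z) \<le> 2 ^ (n - card S1 + (n - card S2))" for z
  proof (cases "fib z = {}")
    case False
    then obtain x y where "x \<in> words n" "tap n S1 x = fst z" "tap n S2 y = snd z"
      by (auto simp: fib_def)
    then have "card (fib z) = 2 ^ (n - card S1) * 2 ^ (n - card S2)"
      using card_tap_fibre[OF S(1), of x] card_tap_fibre[OF S(2), of y]
      by (simp add: fib_def card_cartesian_product)
    then show ?thesis by (simp add: power_add)
  qed simp
  have fin_fib: "finite (fib z)" for z
    by (auto simp: fib_def)
  have "1 - err_prob 2 n R c (0, 1) = measure_pmf.prob J (- err)"
    unfolding err_prob_def J_def err_def[symmetric]
    by (subst measure_pmf.prob_compl[symmetric]) (auto simp: Compl_eq_Diff_UNIV)
  also have "\<dots> \<le> measure_pmf.prob J ((\<lambda>a. (fst a, Y a)) -` E)"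
  proof (rule measure_pmf.finite_measure_mono_AE)
    show "AE a in J. a \<in> - err \<longrightarrow> a \<in> (\<lambda>a. (fst a, Y a)) -` E"
      unfolding AE_measure_pmf_iff
    proof (intro ballI impI)
      fix a assume "a \<in> set_pmf J" and ok: "a \<in> - err"
      then obtain ws u where a: "a = (ws, u)" "ws \<in> file_set 2 n R" "u \<in> set_pmf (rnd c)"
        unfolding J_def set_joint by auto
      have "length ws = 2" using a(2) by (simp add: file_set_def)
      then have "ws = [ws ! 0, ws ! 1]"
        by (auto intro!: nth_equalityI simp: less_Suc_eq numeral_2_eq_2)
      also have "\<dots> = D (plc c ws u) (dlv c (0, 1) ws u)"
        using ok by (simp add: D_def err_def a)
      finally have "ws = D (plc c ws u) (dlv c (0, 1) ws u)" .
      moreover have "(plc c ws u, dlv c (0, 1) ws u) \<in> fib (Y a)"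
        using valid a by (auto simp: fib_def Y_def taps_def words_def valid_code_def demands_def)
      ultimately show "a \<in> (\<lambda>a. (fst a, Y a)) -` E"
        unfolding E_def using a(1) by (auto intro!: rev_image_eqI)
    qed
  qed auto
  also have "\<dots> = measure_pmf.prob (map_pmf (\<lambda>a. (fst a, Y a)) J) E"
    by simp
  finally have 1: "1 - err_prob 2 n R c (0, 1) \<le> measure_pmf.prob (map_pmf (\<lambda>a. (fst a, Y a)) J) E" .
  have 2: "measure_pmf.prob (pair_pmf (map_pmf fst J) (map_pmf Y J)) E
    \<le> 2 ^ (n - card S1 + (n - card S2)) / real (num_msgs n R) ^ 2"
  proof (rule prob_pair_pmf_le)
    fix z
    have "card (file_set 2 n R \<inter> case_prod D ` fib z) \<le> card (case_prod D ` fib z)"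
      using fin_fib by (intro card_mono) auto
    also have "\<dots> \<le> card (fib z)"
      using fin_fib by (rule card_image_le)
    also note card_fib
    finally have "real (card (file_set 2 n R \<inter> case_prod D ` fib z)) \<le> 2 ^ (n - card S1 + (n - card S2))"
      by (metis of_nat_le_iff of_nat_numeral of_nat_power)
    then show "measure_pmf.prob (map_pmf fst J) {x. (x, z) \<in> E}
      \<le> 2 ^ (n - card S1 + (n - card S2)) / real (num_msgs n R) ^ 2"
      unfolding J_def map_fst_joint
      by (subst measure_pmf_of_set) (auto simp: E_def card_file_set intro!: divide_right_mono)
  qed simp
  show ?thesis
    using mutual_information_pmf_ge[OF finite_leakage_support[of n c "(0,1)" S1 S2 2 R], of E] 1 2
    unfolding leakage_eq_taps J_def[symmetric] Y_def[symmetric] by linarith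
qed

lemma finite_tap_sets: "finite (tap_sets n \<alpha>)"
  by (rule finite_subset[of _ "Pow {..<n} \<times> Pow {..<n}"]) (auto simp: tap_sets_def)

lemma finite_demands [simp]: "finite (demands D)"
  by (simp add: demands_def)

lemma achievable_imp_le:
  assumes \<alpha>: "0 < \<alpha>" "\<alpha> \<le> 2" and "achievable 2 \<alpha> R"
  shows "R \<le> 1 - \<alpha> / 2"
proof (rule ccontr)
  assume "\<not> R \<le> 1 - \<alpha> / 2"
  then have R: "2 * R - 2 + \<alpha> > 0" by (simp add: field_simps)
  obtain codes where valid: "\<And>n. valid_code 2 n R (codes n)"
    and err: "(\<lambda>n. max_err 2 n R (codes n)) \<longlonglongrightarrow> 0"
    and leak: "(\<lambda>n. max_leak 2 n R \<alpha> (codes n)) \<longlonglongrightarrow> 0"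
    using \<open>achievable 2 \<alpha> R\<close> by (auto simp: achievable_def)
  have bound: "1 \<le> max_err 2 n R (codes n) + 4 * 2 powr (- (real n * (2 * R - 2 + \<alpha>)))
      + ln 2 * max_leak 2 n R \<alpha> (codes n)" for n
  proof -
    \<comment> \<open>\<open>m\<close> is the whole tapping budget. It is spent on the placement
      word first and the excess goes to the delivery word, where it fits because \<alpha> is at most
      2.\<close>
    define m where "m = nat \<lfloor>\<alpha> * real n\<rfloor>"
    have m: "real m \<le> \<alpha> * real n" "\<alpha> * real n - 1 \<le> real m"
      using \<alpha> by (auto simp: m_def)
    have "real m \<le> 2 * real n"
      using m(1) \<alpha> by (meson mult_right_mono of_nat_0_le_iff order_trans)
    then have m2: "m \<le> 2 * n" by linarith
    define S1 where "S1 = {..<min n m}"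
    define S2 where "S2 = {..<m - n}"
    have S: "S1 \<subseteq> {..<n}" "S2 \<subseteq> {..<n}" and cS: "card S1 + card S2 = m"
      using m2 by (auto simp: S1_def S2_def)
    have "(S1, S2) \<in> tap_sets n \<alpha>"
      using S cS m(1) by (simp add: tap_sets_def flip: of_nat_add)
    then have "leakage 2 n R (codes n) (0, 1) S1 S2 \<le> max_leak 2 n R \<alpha> (codes n)"
      unfolding max_leak_def
      by (intro Max_ge finite_imageI finite_cartesian_product finite_tap_sets)
         (auto simp: demands_def intro!: rev_image_eqI[where x = "((0,1),S1,S2)"])
    then have l: "ln 2 * leakage 2 n R (codes n) (0, 1) S1 S2 \<le> ln 2 * max_leak 2 n R \<alpha> (codes n)"
      by (intro mult_left_mono) auto
    have e: "err_prob 2 n R (codes n) (0, 1) \<le> max_err 2 n R (codes n)"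
      unfolding max_err_def by (intro Max_ge) (auto simp: demands_def)
    have "n - card S1 + (n - card S2) = 2 * n - m"
      using m2 by (auto simp: S1_def S2_def)
    then have "(2::real) ^ (n - card S1 + (n - card S2)) = 2 powr (2 * real n - real m)"
      using m2 by (simp add: powr_realpow[symmetric] of_nat_diff)
    \<comment> \<open>Rounding the budget down loses less than one bit, hence the
      \<open>+ 1\<close>; with the factor 2 of \<open>leakage_lower_bound\<close> it produces the 4
      in the claim.\<close>
    also have "\<dots> \<le> 2 powr (2 * real n - \<alpha> * real n + 1)"
      using m by (intro powr_mono) auto
    finally have p: "(2::real) ^ (n - card S1 + (n - card S2)) \<le> 2 powr (2 * real n - \<alpha> * real n + 1)" .
    have "(2 powr (real n * R)) ^ 2 \<le> real (num_msgs n R) ^ 2"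
      by (intro power_mono num_msgs_ge) auto
    then have q: "2 powr (2 * real n * R) \<le> real (num_msgs n R) ^ 2"
      by (simp add: powr_power mult.commute mult.left_commute)
    have "2 ^ (n - card S1 + (n - card S2)) / real (num_msgs n R) ^ 2
       \<le> 2 powr (2 * real n - \<alpha> * real n + 1) / 2 powr (2 * real n * R)"
      using p q by (intro frac_le) auto
    also have "\<dots> = 2 powr (1 - real n * (2 * R - 2 + \<alpha>))"
      unfolding powr_diff[symmetric] by (rule arg_cong[of _ _ "\<lambda>t. 2 powr t"]) (simp add: algebra_simps)
    also have "\<dots> = 2 * 2 powr (- (real n * (2 * R - 2 + \<alpha>)))"
      unfolding powr_diff powr_minus by (simp add: divide_inverse)
    finally show ?thesis
      using leakage_lower_bound[OF valid[of n] S] l e by linarith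
  qed
  have "(\<lambda>n. 2 powr (- (real n * \<eta>))) \<longlonglongrightarrow> 0" if "\<eta> > 0" for \<eta> :: real
    using that by real_asymp
  from this[OF R] have "(\<lambda>n. 2 powr (- (real n * (2 * R - 2 + \<alpha>)))) \<longlonglongrightarrow> 0" .
  then have "(\<lambda>n. max_err 2 n R (codes n) + 4 * 2 powr (- (real n * (2 * R - 2 + \<alpha>)))
      + ln 2 * max_leak 2 n R \<alpha> (codes n)) \<longlonglongrightarrow> 0 + 4 * 0 + ln 2 * 0"
    by (intro tendsto_intros err leak)
  then have "(1::real) \<le> 0"
    using bound by (intro LIMSEQ_le_const[of _ 0 1]) auto
  then show False by simp
qed

section \<open>Random hash functions\<close>

lemma exp_le_quadratic:
  fixes y :: real
  assumes "y \<le> 1"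
  shows "exp y \<le> 1 + y + y\<^sup>2"
proof (cases "y \<ge> 0")
  case True
  then show ?thesis using assms exp_bound by auto
next
  case False
  \<comment> \<open>The left side is at most 1, while
    \<open>(1 + y + y\<^sup>2) * (1 - y) = 1 - y ^ 3\<close> is at least 1 for negative
    \<open>y\<close>.\<close>
  have "exp y * (1 - y) \<le> exp y * exp (- y)"
    using exp_ge_add_one_self[of "- y"] by (intro mult_left_mono) auto
  also have "\<dots> \<le> (1 + y + y\<^sup>2) * (1 - y)"
    using False by (simp add: exp_minus algebra_simps power2_eq_square mult_nonpos_nonneg)
  finally show ?thesis
    using False by (simp add: mult_le_cancel_right)
qed

text \<open>The moment generating function of a uniformly random \<open>h\<close>, written as a sum
  over all functions. Independence of the values \<open>h x\<close> is the exchange of product and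
  sum. Since \<open>t\<close> may have either sign, one estimate serves both tails.\<close>

lemma sum_exp_PiE_le:
  fixes f :: "'l \<Rightarrow> real"
  assumes X: "finite X" and L: "finite L" "L \<noteq> {}" and A: "A \<subseteq> X"
    and f: "\<And>l. l \<in> L \<Longrightarrow> 0 \<le> f l \<and> f l \<le> \<Delta>" and t: "\<bar>t\<bar> * \<Delta> \<le> 1"
  shows "(\<Sum>h\<in>PiE X (\<lambda>_. L). exp (t * (\<Sum>x\<in>A. f (h x))))
    \<le> card L ^ card X * exp ((t + t\<^sup>2 * \<Delta>) * (card A * (\<Sum>l\<in>L. f l) / card L))"
proof -
  define \<mu> where "\<mu> = (\<Sum>l\<in>L. f l) / card L"
  define s where "s = t + t\<^sup>2 * \<Delta>"
  have fA: "finite A" using A X finite_subset by blast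
  have cL: "real (card L) > 0" using L by (simp add: card_gt_0_iff)
  have exp_f: "exp (t * f l) \<le> 1 + s * f l" if "l \<in> L" for l
  proof -
    have "\<bar>t * f l\<bar> \<le> \<bar>t\<bar> * \<Delta>"
      using f[OF that] by (auto simp: abs_mult intro!: mult_left_mono)
    then have "t * f l \<le> 1" using t by linarith
    then have "exp (t * f l) \<le> 1 + t * f l + (t * f l)\<^sup>2"
      by (rule exp_le_quadratic)
    \<comment> \<open>Replacing one factor \<open>f l\<close> by \<Delta> keeps the bound linear in
      \<open>f l\<close>, so that only the mean of \<open>f\<close> enters below.\<close>
    also have "(t * f l)\<^sup>2 \<le> t\<^sup>2 * (\<Delta> * f l)"
      unfolding power_mult_distrib using f[OF that]
      by (intro mult_left_mono) (auto simp: power2_eq_square intro!: mult_right_mono)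
    finally show ?thesis by (simp add: s_def algebra_simps)
  qed
  have "(\<Sum>l\<in>L. exp (t * f l)) \<le> (\<Sum>l\<in>L. 1 + s * f l)"
    by (intro sum_mono exp_f)
  also have "\<dots> = card L * (1 + s * \<mu>)"
    using cL by (simp add: sum.distrib \<mu>_def field_simps flip: sum_distrib_left)
  also have "\<dots> \<le> card L * exp (s * \<mu>)"
    using cL by (intro mult_left_mono) auto
  finally have one: "(\<Sum>l\<in>L. exp (t * f l)) \<le> card L * exp (s * \<mu>)" .
  have "(\<Sum>h\<in>PiE X (\<lambda>_. L). exp (t * (\<Sum>x\<in>A. f (h x))))
      = (\<Sum>h\<in>PiE X (\<lambda>_. L). \<Prod>x\<in>X. if x \<in> A then exp (t * f (h x)) else 1)"
  proof (intro sum.cong refl)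
    fix h
    have "exp (t * (\<Sum>x\<in>A. f (h x))) = (\<Prod>x\<in>A. exp (t * f (h x)))"
      using fA by (simp add: sum_distrib_left exp_sum)
    also have "\<dots> = (\<Prod>x\<in>X. if x \<in> A then exp (t * f (h x)) else 1)"
      using X A by (simp add: prod.If_cases Int_absorb1)
    finally show "exp (t * (\<Sum>x\<in>A. f (h x))) = \<dots>" .
  qed
  also have "\<dots> = (\<Prod>x\<in>X. \<Sum>l\<in>L. if x \<in> A then exp (t * f l) else 1)"
    using X L by (subst prod_sum_PiE) auto
  also have "\<dots> \<le> (\<Prod>x\<in>X. if x \<in> A then card L * exp (s * \<mu>) else card L)"
    using one by (intro prod_mono) (auto intro!: sum_nonneg)
  also have "\<dots> = (\<Prod>x\<in>X. card L * (if x \<in> A then exp (s * \<mu>) else 1))"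
    by (intro prod.cong) auto
  also have "\<dots> = card L ^ card X * exp (s * \<mu>) ^ card A"
    using X A by (simp add: prod.distrib prod.If_cases Int_absorb1)
  also have "exp (s * \<mu>) ^ card A = exp (s * (card A * (\<Sum>l\<in>L. f l) / card L))"
    by (simp add: \<mu>_def flip: exp_of_nat_mult)
  finally show ?thesis by (simp add: s_def)
qed

text \<open>The exponential Markov inequality in counting form.\<close>

lemma card_exceeding_le:
  fixes g :: "'h \<Rightarrow> real"
  assumes "finite F"
  shows "card {h \<in> F. g h \<ge> c} * exp c \<le> (\<Sum>h\<in>F. exp (g h))"
proof -
  have "card {h \<in> F. g h \<ge> c} * exp c = (\<Sum>h\<in>{h \<in> F. g h \<ge> c}. exp c)" by simp
  also have "\<dots> \<le> (\<Sum>h\<in>{h \<in> F. g h \<ge> c}. exp (g h))" by (intro sum_mono) auto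
  also have "\<dots> \<le> (\<Sum>h\<in>F. exp (g h))" using assms by (intro sum_mono2) auto
  finally show ?thesis .
qed

text \<open>\<open>M\<close> may exceed the mean, because for positive \<open>t\<close> the moment
  bound is increasing in the mean. This permits raising \<open>M\<close> when the mean is too small
  for concentration.\<close>

lemma chernoff_upper:
  fixes f :: "'l \<Rightarrow> real"
  assumes X: "finite X" and L: "finite L" "L \<noteq> {}" and A: "A \<subseteq> X"
    and f: "\<And>l. l \<in> L \<Longrightarrow> 0 \<le> f l \<and> f l \<le> \<Delta>" and \<Delta>: "\<Delta> > 0" and \<delta>: "0 < \<delta>" "\<delta> \<le> 1"
    and M: "card A * (\<Sum>l\<in>L. f l) / card L \<le> M"
  shows "card {h \<in> PiE X (\<lambda>_. L). (\<Sum>x\<in>A. f (h x)) > (1 + \<delta>) * M}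
    \<le> card L ^ card X * exp (- \<delta>\<^sup>2 * M / (4 * \<Delta>))"
proof -
  \<comment> \<open>The minimiser of \<open>t\<^sup>2 * \<Delta> * M - t * \<delta> * M\<close>,
    with minimum \<open>- \<delta>\<^sup>2 * M / (4 * \<Delta>)\<close>.\<close>
  define t where "t = \<delta> / (2 * \<Delta>)"
  let ?F = "PiE X (\<lambda>_. L)"
  have t: "t > 0" "\<bar>t\<bar> * \<Delta> \<le> 1"
    using \<Delta> \<delta> by (auto simp: t_def)
  have fin: "finite ?F" using X L by (intro finite_PiE) auto
  have "card {h \<in> ?F. (\<Sum>x\<in>A. f (h x)) > (1 + \<delta>) * M}
      \<le> card {h \<in> ?F. t * (\<Sum>x\<in>A. f (h x)) \<ge> t * ((1 + \<delta>) * M)}"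
    using fin t by (intro card_mono) auto
  then have "card {h \<in> ?F. (\<Sum>x\<in>A. f (h x)) > (1 + \<delta>) * M} * exp (t * ((1 + \<delta>) * M))
     \<le> card {h \<in> ?F. t * (\<Sum>x\<in>A. f (h x)) \<ge> t * ((1 + \<delta>) * M)} * exp (t * ((1 + \<delta>) * M))"
    by (intro mult_right_mono) auto
  also have "\<dots> \<le> (\<Sum>h\<in>?F. exp (t * (\<Sum>x\<in>A. f (h x))))"
    using fin by (rule card_exceeding_le)
  also have "\<dots> \<le> card L ^ card X * exp ((t + t\<^sup>2 * \<Delta>) * (card A * (\<Sum>l\<in>L. f l) / card L))"
    using X L A f t(2) by (rule sum_exp_PiE_le)
  also have "\<dots> \<le> card L ^ card X * exp ((t + t\<^sup>2 * \<Delta>) * M)"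
    using mult_left_mono[OF M, of "t + t\<^sup>2 * \<Delta>"] t(1) \<Delta> by (intro mult_left_mono) auto
  also have "(t + t\<^sup>2 * \<Delta>) * M = - \<delta>\<^sup>2 * M / (4 * \<Delta>) + t * ((1 + \<delta>) * M)"
    using \<Delta> by (simp add: t_def field_simps power2_eq_square)
  finally show ?thesis
    unfolding exp_add mult.assoc[symmetric] by (rule mult_right_le_imp_le) simp
qed

text \<open>The argument for the upper tail with negative \<open>t\<close>. The coefficient
  \<open>t + t\<^sup>2 * \<Delta>\<close> is now negative, so the mean itself is taken instead of an
  upper bound for it.\<close>

lemma chernoff_lower:
  fixes f :: "'l \<Rightarrow> real"
  assumes X: "finite X" and L: "finite L" "L \<noteq> {}" and A: "A \<subseteq> X"
    and f: "\<And>l. l \<in> L \<Longrightarrow> 0 \<le> f l \<and> f l \<le> \<Delta>" and \<Delta>: "\<Delta> > 0" and \<delta>: "0 < \<delta>" "\<delta> \<le> 1"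
    and m: "m = card A * (\<Sum>l\<in>L. f l) / card L"
  shows "card {h \<in> PiE X (\<lambda>_. L). (\<Sum>x\<in>A. f (h x)) < (1 - \<delta>) * m}
    \<le> card L ^ card X * exp (- \<delta>\<^sup>2 * m / (4 * \<Delta>))"
proof -
  define t where "t = - \<delta> / (2 * \<Delta>)"
  let ?F = "PiE X (\<lambda>_. L)"
  have t: "t < 0" "\<bar>t\<bar> * \<Delta> \<le> 1"
    using \<Delta> \<delta> by (auto simp: t_def)
  have fin: "finite ?F" using X L by (intro finite_PiE) auto
  have "card {h \<in> ?F. (\<Sum>x\<in>A. f (h x)) < (1 - \<delta>) * m}
      \<le> card {h \<in> ?F. t * (\<Sum>x\<in>A. f (h x)) \<ge> t * ((1 - \<delta>) * m)}"
    using fin t by (intro card_mono) auto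
  then have "card {h \<in> ?F. (\<Sum>x\<in>A. f (h x)) < (1 - \<delta>) * m} * exp (t * ((1 - \<delta>) * m))
     \<le> card {h \<in> ?F. t * (\<Sum>x\<in>A. f (h x)) \<ge> t * ((1 - \<delta>) * m)} * exp (t * ((1 - \<delta>) * m))"
    by (intro mult_right_mono) auto
  also have "\<dots> \<le> (\<Sum>h\<in>?F. exp (t * (\<Sum>x\<in>A. f (h x))))"
    using fin by (rule card_exceeding_le)
  also have "\<dots> \<le> card L ^ card X * exp ((t + t\<^sup>2 * \<Delta>) * m)"
    unfolding m using X L A f t(2) by (rule sum_exp_PiE_le)
  also have "(t + t\<^sup>2 * \<Delta>) * m = - \<delta>\<^sup>2 * m / (4 * \<Delta>) + t * ((1 - \<delta>) * m)"
    using \<Delta> by (simp add: t_def field_simps power2_eq_square)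
  finally show ?thesis
    unfolding exp_add mult.assoc[symmetric] by (rule mult_right_le_imp_le) simp
qed

section \<open>Union bound and existence of good hash functions\<close>

lemma exists_avoiding:
  fixes F :: "'h set" and p :: real
  assumes "finite F" "finite \<B>" "\<And>B. B \<in> \<B> \<Longrightarrow> B \<subseteq> F \<and> card B \<le> card F * p"
    and "card \<B> * p < 1" "F \<noteq> {}"
  shows "\<exists>h\<in>F. \<forall>B\<in>\<B>. h \<notin> B"
proof (rule ccontr)
  assume "\<not> ?thesis"
  then have "F \<subseteq> \<Union>\<B>" by blast
  then have "card F \<le> card (\<Union>\<B>)"
    using assms by (intro card_mono finite_Union) (use finite_subset in blast)+
  also have "\<dots> \<le> (\<Sum>B\<in>\<B>. card B)" by (rule card_Union_le_sum_card)
  finally have "real (card F) \<le> (\<Sum>B\<in>\<B>. real (card B))"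
    by (metis of_nat_le_iff of_nat_sum)
  also have "\<dots> \<le> (\<Sum>B\<in>\<B>. card F * p)"
    using assms(3) by (intro sum_mono) auto
  also have "\<dots> = card F * (card \<B> * p)" by simp
  also have "\<dots> < real (card F) * 1"
    using assms by (intro mult_strict_left_mono) (auto simp: card_gt_0_iff)
  finally show False by simp
qed

lemma sum_indicator_eq_card:
  "finite A \<Longrightarrow> (\<Sum>x\<in>A. if P x then 1 else 0 :: real) = card {x \<in> A. P x}"
  by (simp add: sum.If_cases Int_def)

text \<open>A test \<open>(A, f, M, \<Delta>)\<close> asks that the total \<open>f\<close>-weight of
  the labels on \<open>A\<close> hardly exceed \<open>M\<close>. As \<open>M\<close> is at least
  \<open>r * \<Delta>\<close>, a test fails for a fraction of at most
  \<open>exp (- \<delta>\<^sup>2 * r / 4)\<close> of all functions. By \<open>big\<close> the same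
  holds for the lower bound on each bin, and \<open>few\<close> is the union bound.\<close>

lemma exists_hash:
  fixes T :: "('x set \<times> ('l \<Rightarrow> real) \<times> real \<times> real) set" and r \<delta> :: real
  assumes X: "finite X" and L: "finite L" "L \<noteq> {}" and T: "finite T"
    and \<delta>: "0 < \<delta>" "\<delta> \<le> 1"
    and tests: "\<And>A (f :: 'l \<Rightarrow> real) M \<Delta>. (A, f, M, \<Delta>) \<in> T \<Longrightarrow> A \<subseteq> X \<and> (\<forall>l\<in>L. 0 \<le> f l \<and> f l \<le> \<Delta>) \<and> \<Delta> > 0 \<and>
       card A * (\<Sum>l\<in>L. f l) / card L \<le> M \<and> r * \<Delta> \<le> M"
    and big: "r * card L \<le> card X"
    and few: "(real (card T) + real (card L)) * exp (- \<delta>\<^sup>2 * r / 4) < 1"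
  shows "\<exists>h\<in>PiE X (\<lambda>_. L). (\<forall>l\<in>L. (1 - \<delta>) * card X / card L \<le> card {x \<in> X. h x = l}) \<and>
     (\<forall>(A, f, M, \<Delta>)\<in>T. (\<Sum>x\<in>A. f (h x)) \<le> (1 + \<delta>) * M)"
proof -
  define F where "F = PiE X (\<lambda>_. L)"
  define p where "p = exp (- \<delta>\<^sup>2 * r / 4)"
  define up where "up = (\<lambda>(A, f, M::real, \<Delta>::real). {h \<in> F. (\<Sum>x\<in>A. f (h x) :: real) > (1 + \<delta>) * M})"
  define ind where "ind = (\<lambda>(l::'l) l'. if l' = l then 1 else 0 :: real)"
  define lo where "lo = (\<lambda>l. {h \<in> F. (\<Sum>x\<in>X. ind l (h x)) < (1 - \<delta>) * (card X / card L)})"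
  have cL: "real (card L) > 0" using L by (simp add: card_gt_0_iff)
  have cF: "real (card F) = card L ^ card X"
    unfolding F_def using X by (subst card_PiE) auto
  have "\<exists>h\<in>F. \<forall>B\<in>up ` T \<union> lo ` L. h \<notin> B"
  proof (rule exists_avoiding)
    show "finite F" unfolding F_def using X L by (intro finite_PiE) auto
    show "F \<noteq> {}" using L by (auto simp: F_def PiE_eq_empty_iff)
    show "finite (up ` T \<union> lo ` L)" using T L by auto
    have "real (card (up ` T \<union> lo ` L)) \<le> real (card T) + real (card L)"
      using card_Un_le[of "up ` T" "lo ` L"] card_image_le[OF T, of up] card_image_le[OF L(1), of lo]
      by linarith
    then have "card (up ` T \<union> lo ` L) * p \<le> (real (card T) + real (card L)) * p"
      by (intro mult_right_mono) (auto simp: p_def)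
    then show "card (up ` T \<union> lo ` L) * p < 1"
      using few unfolding p_def by linarith
  next
    fix B assume "B \<in> up ` T \<union> lo ` L"
    then show "B \<subseteq> F \<and> card B \<le> card F * p"
    proof
      assume "B \<in> up ` T"
      then obtain A f M \<Delta> where t: "(A, f, M, \<Delta>) \<in> T" and B: "B = up (A, f, M, \<Delta>)" by auto
      note c = tests[OF t]
      have "card B \<le> card F * exp (- \<delta>\<^sup>2 * M / (4 * \<Delta>))"
        unfolding B up_def cF prod.case unfolding F_def
        by (rule chernoff_upper) (use X L \<delta> c in auto)
      also have "\<dots> \<le> card F * p"
        using c \<delta> by (auto simp: p_def field_simps intro!: mult_left_mono)
      finally show ?thesis by (auto simp: B up_def)
    next
      assume "B \<in> lo ` L"
      then obtain l where l: "l \<in> L" and B: "B = lo l" by auto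
      have "(\<Sum>l'\<in>L. ind l l') = 1"
        using l L by (simp add: ind_def)
      then have "card B \<le> card F * exp (- \<delta>\<^sup>2 * (card X / card L) / (4 * 1))"
        unfolding B lo_def cF unfolding F_def
        by (intro chernoff_lower) (use X L \<delta> in \<open>auto simp: ind_def\<close>)
      also have "\<dots> \<le> card F * p"
        using big \<delta> cL by (auto simp: p_def field_simps intro!: mult_left_mono)
      finally show ?thesis by (auto simp: B lo_def)
    qed
  qed
  then obtain h where hF: "h \<in> F" and hB: "\<forall>B\<in>up ` T \<union> lo ` L. h \<notin> B" by (rule bexE)
  note h = hF bspec[OF hB]
  have "(1 - \<delta>) * card X / card L \<le> card {x \<in> X. h x = l}" if "l \<in> L" for l
    using h(1) h(2)[of "lo l"] that X by (auto simp: lo_def ind_def sum_indicator_eq_card)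
  moreover have "(\<Sum>x\<in>A. f (h x)) \<le> (1 + \<delta>) * M" if "(A, f, M, \<Delta>) \<in> T" for A f M \<Delta>
    using h(1) h(2)[of "up (A, f, M, \<Delta>)"] that by (force simp: up_def)
  ultimately show ?thesis
    using hF unfolding F_def by (intro bexI[of _ h] conjI ballI) auto
qed

text \<open>\<open>C\<close> holds the label component fixed by the files, \<open>Q\<close> the
  keys, and \<pi> is the masking of a key. The function \<open>h\<close> is chosen first. With
  \<open>h\<close> frozen, the sum over keys is a single weighted test for \<open>k\<close>, whose
  weights are bin counts of \<open>h\<close> on \<open>A\<close>; so concentration is only ever
  applied to one random function at a time.\<close>

lemma exists_hash_pair:
  fixes X :: "'x set" and C :: "'c set" and Q :: "'q set"
    and \<P> :: "('x set \<times> 'x set) set" and \<W> :: "('c \<times> 'c \<times> ('q \<Rightarrow> 'q)) set" and r \<delta> :: real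
  assumes X: "finite X" and C: "finite C" "C \<noteq> {}" and Q: "finite Q" "Q \<noteq> {}"
    and \<A>: "finite \<A>" "\<And>A. A \<in> \<A> \<Longrightarrow> A \<subseteq> X"
    and \<P>: "\<P> \<subseteq> \<A> \<times> \<A>"
      "\<And>A B. (A, B) \<in> \<P> \<Longrightarrow> r\<^sup>2 * (card C)\<^sup>2 * card Q \<le> real (card A) * card B"
      "\<And>A B. (A, B) \<in> \<P> \<Longrightarrow> card C = 1 \<or> r * card C \<le> card A \<and> r * card C \<le> card B"
    and \<W>: "finite \<W>" "\<And>c e \<pi>. (c, e, \<pi>) \<in> \<W> \<Longrightarrow> c \<in> C \<and> e \<in> C \<and> inj_on \<pi> Q \<and> \<pi> ` Q \<subseteq> Q"
    and \<delta>: "0 < \<delta>" "\<delta> \<le> 1" and r: "r \<ge> 1"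
    and big: "r * (card C * card Q) \<le> card X"
    and few1: "(real (card \<A>) * card C + real (card \<A>) * (card C * card Q) + card C * card Q) * exp (- \<delta>\<^sup>2 * r / 4) < 1"
    and few2: "(real (card \<P>) * card \<W> + card C * card Q) * exp (- \<delta>\<^sup>2 * r / 4) < 1"
  obtains h k where "h \<in> X \<rightarrow> C \<times> Q" "k \<in> X \<rightarrow> C \<times> Q"
    "\<And>l. l \<in> C \<times> Q \<Longrightarrow> (1 - \<delta>) * card X / (card C * card Q) \<le> card {x \<in> X. h x = l}"
    "\<And>l. l \<in> C \<times> Q \<Longrightarrow> (1 - \<delta>) * card X / (card C * card Q) \<le> card {x \<in> X. k x = l}"
    "\<And>A B c e \<pi>. (A, B) \<in> \<P> \<Longrightarrow> (c, e, \<pi>) \<in> \<W> \<Longrightarrow>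
       (\<Sum>q\<in>Q. real (card {x \<in> A. h x = (c, q)}) * card {x \<in> B. k x = (e, \<pi> q)})
         \<le> (1 + \<delta>)\<^sup>2 * (real (card A) * card B / ((card C)\<^sup>2 * card Q))"
proof -
  let ?L = "C \<times> Q"
  have cL: "card ?L = card C * card Q" by (rule card_cartesian_product)
  have L: "finite ?L" "?L \<noteq> {}" using C Q by auto
  have cC: "real (card C) > 0" and cQ: "real (card Q) > 0"
    using C Q by (auto simp: card_gt_0_iff)
  have fin_\<A>: "finite A" if "A \<in> \<A>" for A
    using \<A>(2)[OF that] X finite_subset by blast
  have fin_\<P>: "finite \<P>" using \<P>(1) \<A>(1) finite_subset by blast

  \<comment> \<open>\<open>T1\<close> controls the label component in \<open>C\<close> alone; it
    will bound the mean of the weights used for \<open>k\<close>.\<close>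
  define T1 :: "('x set \<times> ('c \<times> 'q \<Rightarrow> real) \<times> real \<times> real) set" where
    "T1 = (\<lambda>(A, c). (A, \<lambda>l. if fst l = c then 1 else 0, card A / card C, 1))
       ` ({A \<in> \<A>. r * card C \<le> card A} \<times> C)"
  \<comment> \<open>\<open>T2\<close> bounds single bins, hence the largest weight used for
    \<open>k\<close>. A bin of expected size below \<open>r\<close> need not concentrate, so its
    bound is raised to \<open>r\<close>.\<close>
  define T2 :: "('x set \<times> ('c \<times> 'q \<Rightarrow> real) \<times> real \<times> real) set" where
    "T2 = (\<lambda>(A, l). (A, \<lambda>l'. if l' = l then 1 else 0, max (card A / (card C * card Q)) r, 1)) ` (\<A> \<times> ?L)"
  have "card T1 \<le> card ({A \<in> \<A>. r * card C \<le> card A} \<times> C)"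
    unfolding T1_def using \<A> C by (intro card_image_le) auto
  also have "\<dots> \<le> card \<A> * card C"
    unfolding card_cartesian_product using \<A> by (intro mult_right_mono card_mono) auto
  finally have c1: "card T1 \<le> card \<A> * card C" .
  have "card T2 \<le> card (\<A> \<times> ?L)"
    unfolding T2_def using \<A> L by (intro card_image_le) auto
  then have c2: "card T2 \<le> card \<A> * (card C * card Q)"
    by (simp add: card_cartesian_product)
  have card_fst: "card {l \<in> ?L. fst l = c} = card Q" if "c \<in> C" for c
  proof -
    have "{l \<in> ?L. fst l = c} = {c} \<times> Q" using that by auto
    then show ?thesis by (simp add: card_cartesian_product)
  qed
  have "\<exists>h\<in>PiE X (\<lambda>_. ?L). (\<forall>l\<in>?L. (1 - \<delta>) * card X / card ?L \<le> card {x \<in> X. h x = l}) \<and>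
     (\<forall>(A, f, M, \<Delta>)\<in>T1 \<union> T2. (\<Sum>x\<in>A. f (h x)) \<le> (1 + \<delta>) * M)"
  proof (rule exists_hash[OF X L _ \<delta>])
    show "finite (T1 \<union> T2)" using \<A> C L by (auto simp: T1_def T2_def)
    show "r * card ?L \<le> card X" using big by (simp add: cL)
    have "real (card (T1 \<union> T2)) \<le> real (card \<A>) * card C + real (card \<A>) * (card C * card Q)"
      using card_Un_le[of T1 T2] c1 c2 by (simp flip: of_nat_mult of_nat_add)
    then have "(real (card (T1 \<union> T2)) + real (card ?L)) * exp (- \<delta>\<^sup>2 * r / 4)
      \<le> (real (card \<A>) * card C + real (card \<A>) * (card C * card Q) + card C * card Q) * exp (- \<delta>\<^sup>2 * r / 4)"
      by (intro mult_right_mono) (auto simp: cL)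
    then show "(real (card (T1 \<union> T2)) + real (card ?L)) * exp (- \<delta>\<^sup>2 * r / 4) < 1"
      using few1 by linarith
  next
    fix A f M \<Delta> assume "(A, f, M, \<Delta>) \<in> T1 \<union> T2"
    then show "A \<subseteq> X \<and> (\<forall>l\<in>?L. 0 \<le> f l \<and> f l \<le> \<Delta>) \<and> 0 < \<Delta> \<and>
       card A * (\<Sum>l\<in>?L. f l) / card ?L \<le> M \<and> r * \<Delta> \<le> M"
    proof
      assume "(A, f, M, \<Delta>) \<in> T1"
      then obtain c where "A \<in> \<A>" "r * card C \<le> card A" "c \<in> C"
        and e: "f = (\<lambda>l. if fst l = c then 1 else 0)" "M = card A / card C" "\<Delta> = 1"
        by (auto simp: T1_def)
      moreover have "(\<Sum>l\<in>?L. f l) = card Q"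
        using L card_fst[OF \<open>c \<in> C\<close>] by (simp add: e sum_indicator_eq_card)
      ultimately show ?thesis
        using \<A> cC cQ by (auto simp: cL pos_le_divide_eq)
    next
      assume "(A, f, M, \<Delta>) \<in> T2"
      then obtain l where "A \<in> \<A>" and l: "l \<in> ?L"
        and e: "f = (\<lambda>l'. if l' = l then 1 else 0)" "M = max (card A / (card C * card Q)) r" "\<Delta> = 1"
        by (auto simp: T2_def)
      moreover have "(\<Sum>l\<in>?L. f l) = 1"
        unfolding e using L l by (simp add: sum.delta)
      ultimately show ?thesis
        using \<A> cC cQ by (auto simp: cL)
    qed
  qed
  then obtain h where h: "h \<in> PiE X (\<lambda>_. ?L)"
    and h': "(\<forall>l\<in>?L. (1 - \<delta>) * card X / card ?L \<le> card {x \<in> X. h x = l}) \<and>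
     (\<forall>(A, f, M, \<Delta>)\<in>T1 \<union> T2. (\<Sum>x\<in>A. f (h x)) \<le> (1 + \<delta>) * M)"
    by (rule bexE)
  note h_bins = bspec[OF conjunct1[OF h']]
  have h_T: "(\<Sum>x\<in>A. f (h x)) \<le> (1 + \<delta>) * M" if "(A, f, M, \<Delta>) \<in> T1 \<union> T2" for A f M \<Delta>
    using bspec[OF conjunct2[OF h'] that] by simp
  define N where "N = (\<lambda>A c q. real (card {x \<in> A. h x = (c, q)}))"
  have N_le: "N A c q \<le> (1 + \<delta>) * max (card A / (card C * card Q)) r"
    if "A \<in> \<A>" "c \<in> C" "q \<in> Q" for A c q
  proof -
    have "(A, \<lambda>l'. if l' = (c, q) then 1 else 0, max (card A / (card C * card Q)) r, 1) \<in> T2"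
      unfolding T2_def using that by (intro rev_image_eqI[where x = "(A, (c, q))"]) auto
    from h_T[of A "\<lambda>l'. if l' = (c, q) then 1 else 0", OF UnI2[OF this]] fin_\<A>[OF \<open>A \<in> \<A>\<close>]
    show ?thesis by (simp add: N_def sum_indicator_eq_card)
  qed
  have sum_N: "(\<Sum>q\<in>Q. N A c q) = card {x \<in> A. fst (h x) = c}" if "A \<in> \<A>" for A c
  proof -
    have "{x \<in> A. fst (h x) = c} = (\<Union>q\<in>Q. {x \<in> A. h x = (c, q)})"
      using h \<A>(2)[OF that] by (fastforce simp: PiE_iff)
    moreover have "card (\<Union>q\<in>Q. {x \<in> A. h x = (c, q)}) = (\<Sum>q\<in>Q. card {x \<in> A. h x = (c, q)})"
      using fin_\<A>[OF that] Q by (intro card_UN_disjoint) auto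
    ultimately show ?thesis by (simp add: N_def)
  qed
  have sum_N_le: "(\<Sum>q\<in>Q. N A c q) \<le> (1 + \<delta>) * (card A / card C)"
    if "A \<in> \<A>" "c \<in> C" "r * card C \<le> card A" for A c
  proof -
    have "(A, \<lambda>l. if fst l = c then 1 else 0, card A / card C, 1) \<in> T1"
      unfolding T1_def using that by (intro rev_image_eqI[where x = "(A, c)"]) auto
    from h_T[of A "\<lambda>l. if fst l = c then 1 else 0", OF UnI1[OF this]] fin_\<A>[OF \<open>A \<in> \<A>\<close>]
    show ?thesis by (simp add: sum_N[OF that(1)] sum_indicator_eq_card)
  qed
  \<comment> \<open>If \<open>C\<close> has one element, the first label component is constant and
    the trivial bound by \<open>card A\<close> replaces the test, so small \<open>A\<close> are
    covered too.\<close>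
  have sum_N_le': "(\<Sum>q\<in>Q. N A c q) \<le> (1 + \<delta>) * (card A / card C)"
    if "(A, B) \<in> \<P>" "c \<in> C" for A B c
  proof (cases "card C = 1")
    case True
    have "A \<in> \<A>" using \<P> that by auto
    then have "real (card {x \<in> A. fst (h x) = c}) \<le> card A"
      using fin_\<A> by (auto intro: card_mono)
    also have "\<dots> \<le> (1 + \<delta>) * card A" using \<delta> by (simp add: algebra_simps)
    finally show ?thesis using sum_N[OF \<open>A \<in> \<A>\<close>] True by simp
  qed (use \<P> that sum_N_le in blast)

  \<comment> \<open>A label \<open>(e, \<pi> q)\<close> has as weight the number of words in
    \<open>A\<close> that \<open>h\<close> sends to \<open>(c, q)\<close>. The third entry is the
    mean bound that follows from \<open>T1\<close>, the fourth the weight bound from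
    \<open>T2\<close>.\<close>
  define T3 :: "('x set \<times> ('c \<times> 'q \<Rightarrow> real) \<times> real \<times> real) set" where
    "T3 = (\<lambda>((A, B), (c, e, \<pi>)). (B, \<lambda>l. \<Sum>q\<in>Q. if l = (e, \<pi> q) then N A c q else 0,
        (1 + \<delta>) * (real (card A) * card B / ((card C)\<^sup>2 * card Q)),
        (1 + \<delta>) * max (card A / (card C * card Q)) r)) ` ({(A, B) \<in> \<P>. r * card C \<le> card B} \<times> \<W>)"
  have "card T3 \<le> card ({(A, B) \<in> \<P>. r * card C \<le> card B} \<times> \<W>)"
    unfolding T3_def using fin_\<P> \<W> by (intro card_image_le finite_cartesian_product) (auto intro: finite_subset[OF _ fin_\<P>])
  also have "\<dots> \<le> card \<P> * card \<W>"
    unfolding card_cartesian_product using fin_\<P> by (intro mult_right_mono card_mono) auto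
  finally have c3: "card T3 \<le> card \<P> * card \<W>" .
  have "\<exists>k\<in>PiE X (\<lambda>_. ?L). (\<forall>l\<in>?L. (1 - \<delta>) * card X / card ?L \<le> card {x \<in> X. k x = l}) \<and>
     (\<forall>(A, f, M, \<Delta>)\<in>T3. (\<Sum>x\<in>A. f (k x)) \<le> (1 + \<delta>) * M)"
  proof (rule exists_hash[OF X L _ \<delta>])
    show "finite T3" unfolding T3_def using fin_\<P> \<W>
      by (intro finite_imageI finite_cartesian_product) (auto intro: finite_subset[OF _ fin_\<P>])
    show "r * card ?L \<le> card X" using big by (simp add: cL)
    have "real (card T3) \<le> real (card \<P>) * card \<W>"
      using c3 by (simp flip: of_nat_mult)
    then have "(real (card T3) + real (card ?L)) * exp (- \<delta>\<^sup>2 * r / 4)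
      \<le> (real (card \<P>) * card \<W> + card C * card Q) * exp (- \<delta>\<^sup>2 * r / 4)"
      by (intro mult_right_mono) (auto simp: cL)
    then show "(real (card T3) + real (card ?L)) * exp (- \<delta>\<^sup>2 * r / 4) < 1"
      using few2 by linarith
  next
    fix B f M \<Delta> assume "(B, f, M, \<Delta>) \<in> T3"
    then obtain A c e \<pi> where P: "(A, B) \<in> \<P>" and B: "r * card C \<le> card B" and W: "(c, e, \<pi>) \<in> \<W>"
      and f: "f = (\<lambda>l. \<Sum>q\<in>Q. if l = (e, \<pi> q) then N A c q else 0)"
      and M: "M = (1 + \<delta>) * (real (card A) * card B / ((card C)\<^sup>2 * card Q))"
      and \<Delta>: "\<Delta> = (1 + \<delta>) * max (card A / (card C * card Q)) r"
      by (auto simp: T3_def)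
    have AB: "A \<in> \<A>" "B \<in> \<A>" using P \<P> by auto
    have W': "c \<in> C" "e \<in> C" "inj_on \<pi> Q" "\<pi> ` Q \<subseteq> Q" using \<W>(2)[OF W] by auto
    have \<Delta>_pos: "\<Delta> > 0" using r \<delta> by (auto simp: \<Delta> intro!: mult_pos_pos)
    have "0 \<le> f l \<and> f l \<le> \<Delta>" for l
    proof (cases "\<exists>q\<in>Q. l = (e, \<pi> q)")
      case True
      then obtain q where q: "q \<in> Q" "l = (e, \<pi> q)" by blast
      \<comment> \<open>Injectivity of \<pi> leaves only one key per label, so the weight is a
        single bin count.\<close>
      then have "f l = (\<Sum>q'\<in>Q. if q' = q then N A c q else 0)"
        unfolding f using W' by (intro sum.cong) (auto dest: inj_onD)
      also have "\<dots> = N A c q" using Q q by simp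
      finally show ?thesis
        using N_le[OF AB(1) W'(1) q(1)] by (simp add: \<Delta> N_def)
    next
      case False
      then have "f l = 0" unfolding f by (intro sum.neutral) auto
      then show ?thesis using \<Delta>_pos by simp
    qed
    moreover have "(\<Sum>l\<in>?L. f l) = (\<Sum>q\<in>Q. N A c q)"
    proof -
      have "(\<Sum>l\<in>?L. f l) = (\<Sum>q\<in>Q. \<Sum>l\<in>?L. if l = (e, \<pi> q) then N A c q else 0)"
        unfolding f by (rule sum.swap)
      also have "\<dots> = (\<Sum>q\<in>Q. N A c q)"
        using L W' by (intro sum.cong) (auto simp: sum.delta)
      finally show ?thesis .
    qed
    moreover have "card B * (\<Sum>q\<in>Q. N A c q) / card ?L \<le> M"
    proof -
      have "card B * (\<Sum>q\<in>Q. N A c q) / card ?L \<le> card B * ((1 + \<delta>) * (card A / card C)) / card ?L"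
        using sum_N_le'[OF P W'(1)] by (intro divide_right_mono mult_left_mono) auto
      also have "\<dots> = M"
        by (simp add: M cL power2_eq_square mult_ac)
      finally show ?thesis .
    qed
    moreover have "r * \<Delta> \<le> M"
    proof -
      \<comment> \<open>One inequality for each argument of \<open>max\<close>: the first uses that
        \<open>B\<close> is large, the second the lower bound on
        \<open>card A * card B\<close>.\<close>
      have "r * (card A / (card C * card Q)) \<le> real (card A) * card B / ((card C)\<^sup>2 * card Q)"
      proof -
        have "(r * card C) * (card A / ((card C)\<^sup>2 * card Q)) \<le> card B * (card A / ((card C)\<^sup>2 * card Q))"
          using B by (intro mult_right_mono) auto
        then show ?thesis using cC by (simp add: power2_eq_square field_simps)
      qed
      moreover have "r * r \<le> real (card A) * card B / ((card C)\<^sup>2 * card Q)"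
        using \<P>(2)[OF P] cC cQ by (simp add: pos_le_divide_eq power2_eq_square mult.assoc)
      ultimately have "r * max (card A / (card C * card Q)) r \<le> real (card A) * card B / ((card C)\<^sup>2 * card Q)"
        by (auto simp: max_def)
      then have "(1 + \<delta>) * (r * max (card A / (card C * card Q)) r)
         \<le> (1 + \<delta>) * (real (card A) * card B / ((card C)\<^sup>2 * card Q))"
        using \<delta> by (intro mult_left_mono) auto
      then show ?thesis by (simp only: M \<Delta> mult.left_commute)
    qed
    ultimately show "B \<subseteq> X \<and> (\<forall>l\<in>?L. 0 \<le> f l \<and> f l \<le> \<Delta>) \<and> 0 < \<Delta> \<and>
       card B * (\<Sum>l\<in>?L. f l) / card ?L \<le> M \<and> r * \<Delta> \<le> M"
      using \<A>(2)[OF AB(2)] \<Delta>_pos by simp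
  qed
  then obtain k where k: "k \<in> PiE X (\<lambda>_. ?L)"
    and k': "(\<forall>l\<in>?L. (1 - \<delta>) * card X / card ?L \<le> card {x \<in> X. k x = l}) \<and>
     (\<forall>(A, f, M, \<Delta>)\<in>T3. (\<Sum>x\<in>A. f (k x)) \<le> (1 + \<delta>) * M)"
    by (rule bexE)
  note k_bins = bspec[OF conjunct1[OF k']]
  have k_T: "(\<Sum>x\<in>A. f (k x)) \<le> (1 + \<delta>) * M" if "(A, f, M, \<Delta>) \<in> T3" for A f M \<Delta>
    using bspec[OF conjunct2[OF k'] that] by simp
  show ?thesis
  proof (rule that[of h k])
    show "h \<in> X \<rightarrow> ?L" "k \<in> X \<rightarrow> ?L" using h k by (auto simp: PiE_iff)
    show "(1 - \<delta>) * card X / (card C * card Q) \<le> card {x \<in> X. h x = l}"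
      "(1 - \<delta>) * card X / (card C * card Q) \<le> card {x \<in> X. k x = l}" if "l \<in> ?L" for l
      using h_bins[OF that] k_bins[OF that] by (simp_all add: cL)
  next
    fix A B c e \<pi> assume P: "(A, B) \<in> \<P>" and W: "(c, e, \<pi>) \<in> \<W>"
    have AB: "A \<in> \<A>" "B \<in> \<A>" using P \<P> by auto
    have W': "c \<in> C" "e \<in> C" "inj_on \<pi> Q" "\<pi> ` Q \<subseteq> Q" using \<W>(2)[OF W] by auto
    define G where "G = (\<lambda>q. card {x \<in> B. k x = (e, \<pi> q)})"
    have "(\<Sum>q\<in>Q. N A c q * G q) \<le> (1 + \<delta>)\<^sup>2 * (real (card A) * card B / ((card C)\<^sup>2 * card Q))"
    proof (cases "r * card C \<le> card B")
      case True
      have "(B, \<lambda>l. \<Sum>q\<in>Q. if l = (e, \<pi> q) then N A c q else 0,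
        (1 + \<delta>) * (real (card A) * card B / ((card C)\<^sup>2 * card Q)),
        (1 + \<delta>) * max (card A / (card C * card Q)) r) \<in> T3"
        unfolding T3_def using P W True by (intro rev_image_eqI[where x = "((A, B), (c, e, \<pi>))"]) auto
      from k_T[OF this] have
        "(\<Sum>x\<in>B. \<Sum>q\<in>Q. if k x = (e, \<pi> q) then N A c q else 0) \<le> (1 + \<delta>)\<^sup>2 * (real (card A) * card B / ((card C)\<^sup>2 * card Q))"
        by (simp add: power2_eq_square mult.assoc)
      also have "(\<Sum>x\<in>B. \<Sum>q\<in>Q. if k x = (e, \<pi> q) then N A c q else 0)
        = (\<Sum>q\<in>Q. \<Sum>x\<in>B. if k x = (e, \<pi> q) then N A c q else 0)"
        by (rule sum.swap)
      also have "\<dots> = (\<Sum>q\<in>Q. N A c q * G q)"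
        using fin_\<A>[OF AB(2)] by (intro sum.cong refl) (simp add: sum.If_cases G_def Int_def mult.commute)
      finally show ?thesis .
    next
      case False
      \<comment> \<open>A small \<open>B\<close> forces \<open>A\<close> to be large through the
        product hypothesis, so every bin of \<open>h\<close> on \<open>A\<close> is bounded by
        nearly its average. The bins of \<open>k\<close> in \<open>B\<close> are disjoint and need
        no more than the trivial total \<open>card B\<close>.\<close>
      then have C1: "card C = 1" and B: "card B < r" using \<P>(3)[OF P] by auto
      have "r * (r * card Q) \<le> real (card A) * card B"
        using \<P>(2)[OF P] C1 by (simp add: power2_eq_square mult.assoc)
      also have "\<dots> \<le> r * card A" using B mult_left_mono[of "real (card B)" r "real (card A)"] by (simp add: mult.commute)
      finally have "r * card Q \<le> card A" using r by simp
      then have "max (card A / (card C * card Q)) r = card A / card Q"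
        using cQ C1 by (simp add: max_def field_simps)
      then have "(\<Sum>q\<in>Q. N A c q * G q) \<le> (\<Sum>q\<in>Q. (1 + \<delta>) * (card A / card Q) * G q)"
        using N_le[OF AB(1) W'(1)] by (intro sum_mono mult_right_mono) auto
      also have "\<dots> = (1 + \<delta>) * (card A / card Q) * (\<Sum>q\<in>Q. real (G q))"
        by (simp add: sum_distrib_left)
      also have "\<dots> \<le> (1 + \<delta>) * (card A / card Q) * ((1 + \<delta>) * card B)"
      proof (rule mult_left_mono)
        have "(\<Sum>q\<in>Q. real (G q)) = card (\<Union>q\<in>Q. {x \<in> B. k x = (e, \<pi> q)})"
          unfolding G_def using Q fin_\<A>[OF AB(2)] W'(3)
          by (subst card_UN_disjoint) (auto dest: inj_onD)
        also have "\<dots> \<le> real (card B)"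
          using fin_\<A>[OF AB(2)] by (auto intro: card_mono)
        also have "\<dots> \<le> (1 + \<delta>) * card B" using \<delta> by (simp add: algebra_simps)
        finally show "(\<Sum>q\<in>Q. real (G q)) \<le> (1 + \<delta>) * card B" .
      qed (use \<delta> in simp)
      also have "(1 + \<delta>) * (card A / card Q) * ((1 + \<delta>) * card B)
         = (1 + \<delta>)\<^sup>2 * (real (card A) * card B / ((card C)\<^sup>2 * card Q))"
        using C1 by (simp add: power2_eq_square)
      finally show ?thesis .
    qed
    then show "(\<Sum>q\<in>Q. real (card {x \<in> A. h x = (c, q)}) * card {x \<in> B. k x = (e, \<pi> q)})
         \<le> (1 + \<delta>)\<^sup>2 * (real (card A) * card B / ((card C)\<^sup>2 * card Q))"
      by (simp add: N_def G_def)
  qed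
qed

section \<open>The coding scheme\<close>

definition part1 :: "nat \<Rightarrow> nat \<Rightarrow> nat" where "part1 g w = w mod g"
definition part2 :: "nat \<Rightarrow> nat \<Rightarrow> nat" where "part2 g w = w div g mod g"
definition part3 :: "nat \<Rightarrow> nat \<Rightarrow> nat" where "part3 g w = w div (g * g)"

lemma parts_recombine: "part1 g w + g * part2 g w + g * g * part3 g w = w"
proof -
  have "part3 g w = w div g div g" by (simp add: part3_def div_mult2_eq)
  then have "part1 g w + g * part2 g w + g * g * part3 g w
      = w mod g + g * (w div g mod g + g * (w div g div g))"
    unfolding part1_def part2_def by (simp only: distrib_left mult.assoc add.assoc)
  then show ?thesis by (simp only: mod_mult_div_eq)
qed

lemma parts_less:
  assumes "g > 0"
  shows "part1 g w < g" "part2 g w < g" "w < g * g * q \<Longrightarrow> part3 g w < q"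
  using assms by (auto simp: part1_def part2_def part3_def less_mult_imp_div_less mult.commute)

text \<open>Adding \<open>q\<close> before subtracting keeps the truncated subtraction on
  \<open>nat\<close> exact; receivers undo sums and pads in this form.\<close>

lemma add_mod_cancel:
  fixes a k q :: nat
  assumes "a < q" "k < q"
  shows "((a + k) mod q + q - k) mod q = a"
proof (cases "a + k < q")
  case True
  then show ?thesis using assms by simp
next
  case False
  then have "(a + k) mod q = a + k - q"
    using assms by (simp add: mod_if)
  then show ?thesis using assms False by simp
qed

lemma add_mod_cancel':
  fixes a k q :: nat
  assumes "a < q" "k < q"
  shows "((k + a) mod q + q - k) mod q = a"
  using add_mod_cancel[OF assms] by (simp add: add.commute)

lemma inj_on_add_mod: "a < q \<Longrightarrow> inj_on (\<lambda>k. (a + k) mod q) {..<q}" for a q :: nat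
  by (rule inj_on_inverseI[where g = "\<lambda>v. (v + q - a) mod q"]) (simp add: add_mod_cancel')

section \<open>Labels, encoder and decoders\<close>

abbreviation grid :: "nat \<Rightarrow> (nat \<times> nat) set" where
  "grid m \<equiv> {..<m} \<times> {..<m}"

definition cache_label :: "nat \<Rightarrow> nat list \<Rightarrow> nat \<times> nat" where
  "cache_label g ws = ((part1 g (ws ! 0) + part1 g (ws ! 1)) mod g, (part2 g (ws ! 0) + part2 g (ws ! 1)) mod g)"

text \<open>The entries are crossed. The first one is a part of the file of receiver 1 in the clear
  and lets receiver 0 peel its own part 1 off the cached sum; the second one does the same for parts
  2 with the receivers exchanged.\<close>

definition delivery_label :: "nat \<Rightarrow> nat \<times> nat \<Rightarrow> nat list \<Rightarrow> nat \<times> nat" where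
  "delivery_label g d ws = (part1 g (ws ! snd d), part2 g (ws ! fst d))"

definition masked_label :: "nat \<Rightarrow> nat \<Rightarrow> nat \<times> nat \<Rightarrow> nat list \<Rightarrow> nat \<times> nat \<Rightarrow> nat \<times> nat" where
  "masked_label g q d ws = (\<lambda>(k1, k2). ((part3 g (ws ! fst d) + k1) mod q, (part3 g (ws ! snd d) + k2) mod q))"

text \<open>Receiver \<open>j\<close> caches its component of the sum label together with its own key; the
  delivered label supplies one part in the clear, the other through the cached sum, and the
  third one masked by the key.\<close>

definition hash_code :: "nat \<Rightarrow> nat \<Rightarrow> (bool list \<Rightarrow> (nat \<times> nat) \<times> (nat \<times> nat)) \<Rightarrow>
    (bool list \<Rightarrow> (nat \<times> nat) \<times> (nat \<times> nat)) \<Rightarrow> nat pmf \<Rightarrow>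
    (nat \<Rightarrow> (nat \<times> nat) \<times> ((nat \<times> nat) \<times> (nat \<times> nat) \<Rightarrow> bool list) \<times> ((nat \<times> nat) \<times> (nat \<times> nat) \<Rightarrow> bool list)) \<Rightarrow> cbc_code" where
  "hash_code g q h k r D = \<lparr>
     rnd = r,
     plc = (\<lambda>ws u. case D u of (key, \<phi>, \<psi>) \<Rightarrow> \<phi> (cache_label g ws, key)),
     cch = (\<lambda>j x. case h x of ((c1, c2), (k1, k2)) \<Rightarrow> if j = 0 then c1 * q + k1 else c2 * q + k2),
     dlv = (\<lambda>d ws u. case D u of (key, \<phi>, \<psi>) \<Rightarrow> \<psi> (delivery_label g d ws, masked_label g q d ws key)),
     dec = (\<lambda>d j m y. case k y of ((e1, e2), (v1, v2)) \<Rightarrow>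
       if j = 0
       then (if fst d = snd d then e1 else (m div q + g - e1) mod g) + g * e2
            + g * g * ((v1 + q - m mod q) mod q)
       else e1 + g * (if fst d = snd d then e2 else (m div q + g - e2) mod g)
            + g * g * ((v2 + q - m mod q) mod q)) \<rparr>"

text \<open>With two files and distinct demands, the cached sum is over exactly the two demanded
  files, so subtracting the delivered part leaves the missing one. With equal demands the delivered
  label already contains both parts. The cached number splits by \<open>div q\<close> and
  \<open>mod q\<close> since the keys are below \<open>q\<close>.\<close>

lemma hash_code_decodes:
  fixes ws :: "nat list" and d key :: "nat \<times> nat"
  assumes g: "g > 0" and ws: "\<forall>i<2. ws ! i < g * g * q" and d: "d \<in> demands 2"
    and key: "key \<in> grid q"
    and h: "h x = (cache_label g ws, key)" and k: "k y = (delivery_label g d ws, masked_label g q d ws key)"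
  shows "dec (hash_code g q h k r D) d 0 (cch (hash_code g q h k r D) 0 x) y = ws ! fst d"
    and "dec (hash_code g q h k r D) d 1 (cch (hash_code g q h k r D) 1 x) y = ws ! snd d"
proof -
  obtain k1 k2 where key_eq: "key = (k1, k2)" and k12: "k1 < q" "k2 < q"
    using key by auto
  obtain d1 d2 where d_eq: "d = (d1, d2)" and d12: "d1 < 2" "d2 < 2"
    using d by (auto simp: demands_def)
  note p3 = parts_less(3)[OF g]
  have v1: "((part3 g (ws ! d1) + k1) mod q + q - k1) mod q = part3 g (ws ! d1)"
    using ws d12 k12 by (intro add_mod_cancel p3) auto
  have v2: "((part3 g (ws ! d2) + k2) mod q + q - k2) mod q = part3 g (ws ! d2)"
    using ws d12 k12 by (intro add_mod_cancel p3) auto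
  have s1: "((part1 g (ws ! 0) + part1 g (ws ! 1)) mod g + g - part1 g (ws ! d2)) mod g = part1 g (ws ! d1)"
    if "d1 \<noteq> d2"
    using that d12 by (auto simp: less_2_cases_iff intro!: add_mod_cancel add_mod_cancel' parts_less g)
  have s2: "((part2 g (ws ! 0) + part2 g (ws ! 1)) mod g + g - part2 g (ws ! d1)) mod g = part2 g (ws ! d2)"
    if "d1 \<noteq> d2"
    using that d12 by (auto simp: less_2_cases_iff intro!: add_mod_cancel add_mod_cancel' parts_less g)
  show "dec (hash_code g q h k r D) d 0 (cch (hash_code g q h k r D) 0 x) y = ws ! fst d"
  proof (cases "d1 = d2")
    case True
    then show ?thesis
      using k12 h k v1 parts_recombine[of g "ws ! d1"]
      by (simp add: hash_code_def key_eq d_eq delivery_label_def masked_label_def cache_label_def)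
  next
    case False
    then show ?thesis
      using k12 h k v1 s1[OF False] parts_recombine[of g "ws ! d1"]
      by (simp add: hash_code_def key_eq d_eq delivery_label_def masked_label_def cache_label_def)
  qed
  show "dec (hash_code g q h k r D) d 1 (cch (hash_code g q h k r D) 1 x) y = ws ! snd d"
  proof (cases "d1 = d2")
    case True
    then show ?thesis
      using k12 h k v2 parts_recombine[of g "ws ! d2"]
      by (simp add: hash_code_def key_eq d_eq delivery_label_def masked_label_def cache_label_def)
  next
    case False
    then show ?thesis
      using k12 h k v2 s2[OF False] parts_recombine[of g "ws ! d2"]
      by (simp add: hash_code_def key_eq d_eq delivery_label_def masked_label_def cache_label_def)
  qed
qed

text \<open>The private randomness of a code lives on \<open>nat\<close>; a pmf has countable
  support, so any law is the image of one on \<open>nat\<close>.\<close>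

lemma nat_pmf_simulation:
  fixes P :: "'a pmf"
  obtains r :: "nat pmf" and D where "map_pmf D r = P"
proof
  let ?S = "set_pmf P"
  have "map_pmf (from_nat_into ?S) (map_pmf (to_nat_on ?S) P) = map_pmf id P"
    unfolding map_pmf_comp by (rule map_pmf_cong) auto
  then show "map_pmf (from_nat_into ?S) (map_pmf (to_nat_on ?S) P) = P" by simp
qed

text \<open>Files and private randomness are independent, so the law of the observation for fixed
  files appears as a factor.\<close>

lemma pmf_map_dependent:
  fixes B :: "'u::countable pmf"
  shows "pmf (map_pmf (\<lambda>(x, u). (x, t x u)) (pair_pmf A B)) (x, z) = pmf A x * pmf (map_pmf (t x) B) z"
proof -
  have "(\<lambda>(x, u). (x, t x u)) -` {(x, z)} = {x} \<times> (t x -` {z})" by auto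
  then show ?thesis
    by (simp add: pmf_map measure_pmf_prob_product countable_subset[OF subset_UNIV] measure_pmf_single)
qed

lemma pmf_map_pmf_of_set:
  assumes "finite S" "S \<noteq> {}"
  shows "pmf (map_pmf f (pmf_of_set S)) z = card {x \<in> S. f x = z} / card S"
  using assms by (simp add: pmf_map measure_pmf_of_set vimage_def Int_def)

text \<open>A uniform key, together with independent uniform selections \<open>\<phi>\<close>, \<open>\<psi>\<close> from all bins of the
  two hash functions; only the bins singled out by the files and the demand are ever looked at.\<close>

definition selection_pmf :: "'x set \<Rightarrow> 'c set \<Rightarrow> 'q set \<Rightarrow> 'x \<Rightarrow> ('x \<Rightarrow> 'c \<times> 'q) \<Rightarrow> ('x \<Rightarrow> 'c \<times> 'q) \<Rightarrow>
    ('q \<times> ('c \<times> 'q \<Rightarrow> 'x) \<times> ('c \<times> 'q \<Rightarrow> 'x)) pmf" where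
  "selection_pmf X C Q x0 h k = pair_pmf (pmf_of_set Q)
     (pair_pmf (Pi_pmf (C \<times> Q) x0 (\<lambda>l. pmf_of_set {x \<in> X. h x = l}))
               (Pi_pmf (C \<times> Q) x0 (\<lambda>l. pmf_of_set {x \<in> X. k x = l})))"

lemma set_selection_pmf:
  assumes fin: "finite X" "finite C" "finite Q" "Q \<noteq> {}"
    and ne: "\<And>l. l \<in> C \<times> Q \<Longrightarrow> {x \<in> X. h x = l} \<noteq> {}" "\<And>l. l \<in> C \<times> Q \<Longrightarrow> {x \<in> X. k x = l} \<noteq> {}"
    and s: "(key, \<phi>, \<psi>) \<in> set_pmf (selection_pmf X C Q x0 h k)"
  shows "key \<in> Q" "\<And>l. l \<in> C \<times> Q \<Longrightarrow> \<phi> l \<in> X \<and> h (\<phi> l) = l" "\<And>l. l \<in> C \<times> Q \<Longrightarrow> \<psi> l \<in> X \<and> k (\<psi> l) = l"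
proof -
  have *: "key \<in> set_pmf (pmf_of_set Q)"
    "\<phi> \<in> PiE_dflt (C \<times> Q) x0 (set_pmf \<circ> (\<lambda>l. pmf_of_set {x \<in> X. h x = l}))"
    "\<psi> \<in> PiE_dflt (C \<times> Q) x0 (set_pmf \<circ> (\<lambda>l. pmf_of_set {x \<in> X. k x = l}))"
    using s fin by (auto simp: selection_pmf_def set_Pi_pmf)
  then show "key \<in> Q" using fin by simp
  show "\<phi> l \<in> X \<and> h (\<phi> l) = l" if "l \<in> C \<times> Q" for l
  proof -
    have "\<phi> l \<in> set_pmf (pmf_of_set {x \<in> X. h x = l})"
      using *(2) that by (cases l) (auto simp: PiE_dflt_def)
    then show ?thesis using ne(1)[OF that] fin by (subst (asm) set_pmf_of_set) auto
  qed
  show "\<psi> l \<in> X \<and> k (\<psi> l) = l" if "l \<in> C \<times> Q" for l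
  proof -
    have "\<psi> l \<in> set_pmf (pmf_of_set {x \<in> X. k x = l})"
      using *(3) that by (cases l) (auto simp: PiE_dflt_def)
    then show ?thesis using ne(2)[OF that] fin by (subst (asm) set_pmf_of_set) auto
  qed
qed

text \<open>For a fixed key the two words are independent and uniform on one bin each, so the
  observation has as probability a product of relative bin counts, averaged over the key. Replacing
  the bin sizes by their lower bound \<beta> leaves the sum that \<open>exists_hash_pair\<close>
  controls.\<close>

lemma pmf_selection_le:
  fixes f g :: "'x \<Rightarrow> 'z" and \<beta> :: real
  assumes fin: "finite X" "finite C" "finite Q" "Q \<noteq> {}" and \<beta>: "\<beta> > 0"
    and bins: "\<And>l. l \<in> C \<times> Q \<Longrightarrow> \<beta> \<le> card {x \<in> X. h x = l}" "\<And>l. l \<in> C \<times> Q \<Longrightarrow> \<beta> \<le> card {x \<in> X. k x = l}"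
    and ce: "c \<in> C" "e \<in> C" "\<pi> ` Q \<subseteq> Q"
  shows "pmf (map_pmf (\<lambda>(key, \<phi>, \<psi>). (f (\<phi> (c, key)), g (\<psi> (e, \<pi> key)))) (selection_pmf X C Q x0 h k)) (z1, z2)
    \<le> (\<Sum>key\<in>Q. real (card {x \<in> {x \<in> X. f x = z1}. h x = (c, key)}) *
         card {x \<in> {x \<in> X. g x = z2}. k x = (e, \<pi> key)}) / (card Q * \<beta>\<^sup>2)"
proof -
  let ?b = "\<lambda>h l. pmf_of_set {x \<in> X. h x = l}"
  have ne: "{x \<in> X. h x = l} \<noteq> {}" "{x \<in> X. k x = l} \<noteq> {}" if "l \<in> C \<times> Q" for l
    using bins[OF that] \<beta> by (auto simp del: Collect_empty_eq)
  have cQ: "real (card Q) > 0" using fin by (simp add: card_gt_0_iff)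
  have "map_pmf (\<lambda>(key, \<phi>, \<psi>). (f (\<phi> (c, key)), g (\<psi> (e, \<pi> key)))) (selection_pmf X C Q x0 h k)
     = bind_pmf (pmf_of_set Q) (\<lambda>key. map_pmf (\<lambda>(\<phi>, \<psi>). (f (\<phi> (c, key)), g (\<psi> (e, \<pi> key))))
        (pair_pmf (Pi_pmf (C \<times> Q) x0 (?b h)) (Pi_pmf (C \<times> Q) x0 (?b k))))"
    unfolding selection_pmf_def pair_pmf_def[of "pmf_of_set Q"] map_bind_pmf
    by (simp add: map_pmf_def bind_assoc_pmf bind_return_pmf)
  also have "\<dots> = bind_pmf (pmf_of_set Q) (\<lambda>key. pair_pmf (map_pmf f (?b h (c, key))) (map_pmf g (?b k (e, \<pi> key))))"
  proof (rule bind_pmf_cong[OF refl])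
    fix key assume "key \<in> set_pmf (pmf_of_set Q)"
    then have key: "key \<in> Q" using fin by simp
    have comp: "map_pmf (\<lambda>\<phi>. f' (\<phi> l)) (Pi_pmf (C \<times> Q) x0 p) = map_pmf f' (p l)"
      if "l \<in> C \<times> Q" for l p and f' :: "'x \<Rightarrow> 'z"
      using Pi_pmf_component[of "C \<times> Q" l x0 p] that fin
      by (simp add: map_pmf_comp[of f' "\<lambda>\<phi>. \<phi> l", symmetric])
    show "map_pmf (\<lambda>(\<phi>, \<psi>). (f (\<phi> (c, key)), g (\<psi> (e, \<pi> key))))
        (pair_pmf (Pi_pmf (C \<times> Q) x0 (?b h)) (Pi_pmf (C \<times> Q) x0 (?b k)))
       = pair_pmf (map_pmf f (?b h (c, key))) (map_pmf g (?b k (e, \<pi> key)))"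
      unfolding map_pair using key ce by (subst (1 2) comp) auto
  qed
  finally have "pmf (map_pmf (\<lambda>(key, \<phi>, \<psi>). (f (\<phi> (c, key)), g (\<psi> (e, \<pi> key)))) (selection_pmf X C Q x0 h k)) (z1, z2)
     = (\<Sum>key\<in>Q. pmf (map_pmf f (?b h (c, key))) z1 * pmf (map_pmf g (?b k (e, \<pi> key))) z2) / card Q"
    using fin by (simp add: pmf_bind integral_pmf_of_set pmf_pair)
  also have "\<dots> \<le> (\<Sum>key\<in>Q. real (card {x \<in> {x \<in> X. f x = z1}. h x = (c, key)}) *
         card {x \<in> {x \<in> X. g x = z2}. k x = (e, \<pi> key)} / \<beta>\<^sup>2) / card Q"
  proof (intro divide_right_mono sum_mono)
    fix key assume key: "key \<in> Q"
    then have l: "(c, key) \<in> C \<times> Q" "(e, \<pi> key) \<in> C \<times> Q" using ce by auto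
    have "pmf (map_pmf f (?b h (c, key))) z1 \<le> card {x \<in> {x \<in> X. f x = z1}. h x = (c, key)} / \<beta>"
      using ne(1)[OF l(1)] fin bins(1)[OF l(1)] \<beta>
      by (subst pmf_map_pmf_of_set) (auto intro!: frac_le simp del: Collect_empty_eq simp: conj_ac)
    moreover have "pmf (map_pmf g (?b k (e, \<pi> key))) z2 \<le> card {x \<in> {x \<in> X. g x = z2}. k x = (e, \<pi> key)} / \<beta>"
      using ne(2)[OF l(2)] fin bins(2)[OF l(2)] \<beta>
      by (subst pmf_map_pmf_of_set) (auto intro!: frac_le simp del: Collect_empty_eq simp: conj_ac)
    ultimately have "pmf (map_pmf f (?b h (c, key))) z1 * pmf (map_pmf g (?b k (e, \<pi> key))) z2
       \<le> card {x \<in> {x \<in> X. f x = z1}. h x = (c, key)} / \<beta> * (card {x \<in> {x \<in> X. g x = z2}. k x = (e, \<pi> key)} / \<beta>)"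
      using \<beta> by (intro mult_mono) auto
    then show "pmf (map_pmf f (?b h (c, key))) z1 * pmf (map_pmf g (?b k (e, \<pi> key))) z2
       \<le> real (card {x \<in> {x \<in> X. f x = z1}. h x = (c, key)}) *
         card {x \<in> {x \<in> X. g x = z2}. k x = (e, \<pi> key)} / \<beta>\<^sup>2"
      by (simp add: power2_eq_square)
  qed simp
  also have "\<dots> = (\<Sum>key\<in>Q. real (card {x \<in> {x \<in> X. f x = z1}. h x = (c, key)}) *
         card {x \<in> {x \<in> X. g x = z2}. k x = (e, \<pi> key)}) / (card Q * \<beta>\<^sup>2)"
    by (simp add: mult.commute flip: sum_divide_distrib)
  finally show ?thesis .
qed

section \<open>Error and leakage of codes; codes from hash functions\<close>

lemma max_leak_le:
  assumes "\<alpha> \<ge> 0" "D > 0"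
    and "\<And>d S1 S2. d \<in> demands D \<Longrightarrow> (S1, S2) \<in> tap_sets n \<alpha> \<Longrightarrow> leakage D n R c d S1 S2 \<le> t"
  shows "max_leak D n R \<alpha> c \<le> t"
proof -
  have "({}, {}) \<in> tap_sets n \<alpha>" "(0, 0) \<in> demands D"
    using assms by (auto simp: tap_sets_def demands_def)
  then show ?thesis
    unfolding max_leak_def
    by (intro Max.boundedI finite_imageI finite_cartesian_product finite_tap_sets)
       (use assms(3) in auto)
qed

lemma max_leak_nonneg:
  assumes "\<alpha> \<ge> 0" "D > 0"
  shows "max_leak D n R \<alpha> c \<ge> 0"
proof -
  have "((0, 0), {}, {}) \<in> demands D \<times> tap_sets n \<alpha>"
    using assms by (auto simp: tap_sets_def demands_def)
  then have "leakage D n R c (0, 0) {} {} \<le> max_leak D n R \<alpha> c"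
    unfolding max_leak_def
    by (intro Max_ge finite_imageI finite_cartesian_product finite_tap_sets) (auto intro: rev_image_eqI)
  then show ?thesis using leakage_nonneg order_trans by blast
qed

lemma max_err_eq_0:
  assumes D: "D > 0"
    and ok: "\<And>d ws u. d \<in> demands D \<Longrightarrow> ws \<in> file_set D n R \<Longrightarrow> u \<in> set_pmf (rnd c) \<Longrightarrow>
      dec c d 0 (cch c 0 (plc c ws u)) (dlv c d ws u) = ws ! fst d \<and>
      dec c d 1 (cch c 1 (plc c ws u)) (dlv c d ws u) = ws ! snd d"
  shows "max_err D n R c = 0"
proof -
  have "err_prob D n R c d = 0" if "d \<in> demands D" for d
    unfolding err_prob_def measure_pmf_zero_iff
    using ok[OF that] by (auto simp: set_joint)
  moreover have "demands D \<noteq> {}" using D by (auto simp: demands_def)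
  ultimately have "err_prob D n R c ` demands D = {0}" by auto
  then show ?thesis by (simp add: max_err_def)
qed

text \<open>The tapped bits take \<open>2 ^ (card S1 + card S2)\<close> values; it suffices to
  compare their law for fixed files with the uniform law on these values.\<close>

lemma leakage_le:
  assumes len: "\<And>ws u. ws \<in> file_set D n R \<Longrightarrow> u \<in> set_pmf (rnd c) \<Longrightarrow> length (plc c ws u) = n \<and> length (dlv c d ws u) = n"
    and S: "S1 \<subseteq> {..<n}" "S2 \<subseteq> {..<n}" and \<beta>: "\<beta> > 0"
    and bound: "\<And>ws y1 y2. ws \<in> file_set D n R \<Longrightarrow> y1 \<in> words n \<Longrightarrow> y2 \<in> words n \<Longrightarrow>
      pmf (map_pmf (\<lambda>u. (tap n S1 (plc c ws u), tap n S2 (dlv c d ws u))) (rnd c)) (tap n S1 y1, tap n S2 y2)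
        \<le> \<beta> / 2 ^ (card S1 + card S2)"
  shows "leakage D n R c d S1 S2 \<le> log 2 \<beta>"
  unfolding leakage_eq_taps
proof (rule mutual_information_pmf_le[OF finite_leakage_support _ _ \<beta>])
  let ?B = "(tap n S1 ` words n) \<times> (tap n S2 ` words n)"
  let ?t = "\<lambda>ws u. (tap n S1 (plc c ws u), tap n S2 (dlv c d ws u))"
  let ?P = "map_pmf (\<lambda>a. (fst a, taps n c d S1 S2 a)) (joint D n R c)"
  show "finite ?B" by simp
  show "set_pmf (map_pmf (taps n c d S1 S2) (joint D n R c)) \<subseteq> ?B"
    using len by (auto simp: set_joint taps_def words_def)
  have cB: "real (card ?B) = 2 ^ (card S1 + card S2)"
    using card_tap_image S by (simp add: card_cartesian_product power_add)
  fix ws z assume z: "(ws, z) \<in> set_pmf ?P"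
  then have ws: "ws \<in> file_set D n R" and "\<exists>y1\<in>words n. \<exists>y2\<in>words n. z = (tap n S1 y1, tap n S2 y2)"
    using len by (auto simp: set_joint taps_def words_def)
  then obtain y1 y2 where y: "y1 \<in> words n" "y2 \<in> words n" "z = (tap n S1 y1, tap n S2 y2)"
    by blast
  have "?P = map_pmf (\<lambda>(ws, u). (ws, ?t ws u)) (pair_pmf (pmf_of_set (file_set D n R)) (rnd c))"
    unfolding joint_def taps_def by (rule map_pmf_cong) auto
  then have "pmf ?P (ws, z) = pmf (pmf_of_set (file_set D n R)) ws * pmf (map_pmf (?t ws) (rnd c)) z"
    by (simp only: pmf_map_dependent)
  also have "\<dots> \<le> pmf (pmf_of_set (file_set D n R)) ws * (\<beta> / card ?B)"
    unfolding cB y(3) using bound[OF ws y(1,2)] by (intro mult_left_mono) auto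
  finally show "pmf ?P (ws, z) \<le> \<beta> / card ?B * pmf (map_pmf fst (joint D n R c)) ws"
    by (simp add: map_fst_joint mult.commute)
qed

text \<open>Nonempty bins make every label transmittable, hence decoding is error-free. Dividing
  \<open>uniform\<close> by the squared lower bound on the bins shows that an observation exceeds
  its uniform probability by a factor of at most
  \<open>((1 + \<delta>) / (1 - \<delta>))\<^sup>2\<close>.\<close>

lemma exists_code:
  fixes \<delta> :: real
  assumes g: "g > 0" and q: "q > 0" and K: "num_msgs n R \<le> g * g * q" and cache: "g * q \<le> cache_size n"
    and \<alpha>: "\<alpha> \<ge> 0" and \<delta>: "0 < \<delta>" "\<delta> < 1"
    and h: "h \<in> words n \<rightarrow> grid g \<times> grid q" and k: "k \<in> words n \<rightarrow> grid g \<times> grid q"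
    and bins: "\<And>l. l \<in> grid g \<times> grid q \<Longrightarrow> (1 - \<delta>) * 2 ^ n / ((g * g) * (q * q)) \<le> card {x \<in> words n. h x = l}"
      "\<And>l. l \<in> grid g \<times> grid q \<Longrightarrow> (1 - \<delta>) * 2 ^ n / ((g * g) * (q * q)) \<le> card {x \<in> words n. k x = l}"
    and uniform: "\<And>S1 S2 y1 y2 ws d. (S1, S2) \<in> tap_sets n \<alpha> \<Longrightarrow> y1 \<in> words n \<Longrightarrow> y2 \<in> words n \<Longrightarrow>
      ws \<in> file_set 2 n R \<Longrightarrow> d \<in> demands 2 \<Longrightarrow>
      (\<Sum>key\<in>grid q. real (card {x \<in> {x \<in> words n. tap n S1 x = tap n S1 y1}. h x = (cache_label g ws, key)}) *
         card {x \<in> {x \<in> words n. tap n S2 x = tap n S2 y2}. k x = (delivery_label g d ws, masked_label g q d ws key)})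
       \<le> (1 + \<delta>)\<^sup>2 * (2 ^ (n - card S1) * 2 ^ (n - card S2) / ((real g * g)\<^sup>2 * (q * q)))"
  shows "\<exists>c. valid_code 2 n R c \<and> max_err 2 n R c = 0 \<and>
    max_leak 2 n R \<alpha> c \<le> log 2 (((1 + \<delta>) / (1 - \<delta>))\<^sup>2)"
proof -
  define P where "P = selection_pmf (words n) (grid g) (grid q) [] h k"
  obtain r :: "nat pmf" and D where rD: "map_pmf D r = P" by (rule nat_pmf_simulation)
  define c where "c = hash_code g q h k r D"
  define b where "b = (1 - \<delta>) * 2 ^ n / ((g * g) * (q * q))"
  have b: "b > 0" using g q \<delta> by (simp add: b_def)
  have ne: "{x \<in> words n. h x = l} \<noteq> {}" "{x \<in> words n. k x = l} \<noteq> {}" if "l \<in> grid g \<times> grid q" for l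
    using bins[OF that] b unfolding b_def[symmetric] by (auto simp del: Collect_empty_eq)
  have cl: "cache_label g ws \<in> grid g" and dl: "delivery_label g d ws \<in> grid g"
    and mk: "masked_label g q d ws key \<in> grid q" for ws d key
    using g q by (auto simp: cache_label_def delivery_label_def masked_label_def parts_less split: prod.splits)
  have sel: "key \<in> grid q \<and>
     (\<forall>l\<in>grid g \<times> grid q. \<phi> l \<in> words n \<and> h (\<phi> l) = l) \<and> (\<forall>l\<in>grid g \<times> grid q. \<psi> l \<in> words n \<and> k (\<psi> l) = l)"
    if "u \<in> set_pmf r" "D u = (key, \<phi>, \<psi>)" for u key \<phi> \<psi>
  proof -
    have "D u \<in> set_pmf (map_pmf D r)" using that(1) by simp
    then have "(key, \<phi>, \<psi>) \<in> set_pmf (selection_pmf (words n) (grid g) (grid q) [] h k)"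
      using that(2) rD by (simp add: P_def)
    note s = set_selection_pmf[OF finite_words _ _ _ ne this]
    have Q: "finite (grid g)" "finite (grid q)" "grid q \<noteq> {}" using q by auto
    show ?thesis using s(1)[OF Q] s(2)[OF Q] s(3)[OF Q] by (intro conjI ballI) blast+
  qed
  have len: "plc c ws u \<in> words n" "dlv c d ws u \<in> words n"
    and lab: "key = fst (D u) \<Longrightarrow> h (plc c ws u) = (cache_label g ws, key)"
      "key = fst (D u) \<Longrightarrow> k (dlv c d ws u) = (delivery_label g d ws, masked_label g q d ws key)"
    and keyQ: "fst (D u) \<in> grid q"
    if "u \<in> set_pmf (rnd c)" for ws u d key
  proof -
    obtain key' \<phi> \<psi> where Du: "D u = (key', \<phi>, \<psi>)" by (cases "D u") auto
    have u: "u \<in> set_pmf r" using that by (simp add: c_def hash_code_def)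
    note s = sel[OF u Du]
    have m: "(cache_label g ws, key') \<in> grid g \<times> grid q"
      "(delivery_label g d ws, masked_label g q d ws key') \<in> grid g \<times> grid q"
      using s cl dl mk by blast+
    show "plc c ws u \<in> words n" "dlv c d ws u \<in> words n" "fst (D u) \<in> grid q"
      using s m by (auto simp: c_def hash_code_def Du)
    show "key = fst (D u) \<Longrightarrow> h (plc c ws u) = (cache_label g ws, key)"
      "key = fst (D u) \<Longrightarrow> k (dlv c d ws u) = (delivery_label g d ws, masked_label g q d ws key)"
      using s m by (auto simp: c_def hash_code_def Du)
  qed
  have cch_less: "cch c j x < cache_size n" if "length x = n" for j x
  proof -
    have "x \<in> words n" using that by (simp add: words_def)
    then have "h x \<in> grid g \<times> grid q" using h by blast
    \<comment> \<open>Sum component and key form a mixed-radix number below \<open>g * q\<close>,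
      which fits into the cache.\<close>
    moreover have "a * q + b < g * q" if "a < g" "b < q" for a b
    proof -
      have "a * q + b < a * q + q" using that by simp
      also have "\<dots> = (a + 1) * q" by simp
      also have "\<dots> \<le> g * q" using that by (intro mult_right_mono) auto
      finally show ?thesis .
    qed
    ultimately have "cch c j x < g * q" by (auto simp: c_def hash_code_def)
    then show ?thesis using cache by linarith
  qed
  have "valid_code 2 n R c"
    unfolding valid_code_def using len cch_less by (auto simp: words_def)
  moreover have "max_err 2 n R c = 0"
  proof (rule max_err_eq_0)
    fix d ws u assume d: "d \<in> demands 2" and ws: "ws \<in> file_set 2 n R" and u: "u \<in> set_pmf (rnd c)"
    have "\<forall>i<2. ws ! i < g * g * q"
      using ws K by (auto simp: file_set_def)
        (metis less_le_trans nth_mem)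
    from hash_code_decodes[where h = h and x = "plc c ws u" and k = k and y = "dlv c d ws u" and r = r and D = D,
        OF g this d keyQ[OF u] lab(1)[OF u refl] lab(2)[OF u refl]]
    show "dec c d 0 (cch c 0 (plc c ws u)) (dlv c d ws u) = ws ! fst d \<and>
      dec c d 1 (cch c 1 (plc c ws u)) (dlv c d ws u) = ws ! snd d"
      by (simp only: c_def)
  qed simp
  moreover have "max_leak 2 n R \<alpha> c \<le> log 2 (((1 + \<delta>) / (1 - \<delta>))\<^sup>2)"
  proof (rule max_leak_le[OF \<alpha>])
    fix d S1 S2 assume d: "d \<in> demands 2" and S: "(S1, S2) \<in> tap_sets n \<alpha>"
    then have S': "S1 \<subseteq> {..<n}" "S2 \<subseteq> {..<n}" by (auto simp: tap_sets_def)
    then have cS: "card S1 \<le> n" "card S2 \<le> n"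
      using card_mono[of "{..<n}"] by fastforce+
    show "leakage 2 n R c d S1 S2 \<le> log 2 (((1 + \<delta>) / (1 - \<delta>))\<^sup>2)"
    proof (rule leakage_le[OF _ S'])
      show "((1 + \<delta>) / (1 - \<delta>))\<^sup>2 > 0" using \<delta> by simp
      show "length (plc c ws u) = n \<and> length (dlv c d ws u) = n" if "u \<in> set_pmf (rnd c)" for ws u
        using len[OF that] by (simp add: words_def)
      fix ws y1 y2 assume ws: "ws \<in> file_set 2 n R" and y: "y1 \<in> words n" "y2 \<in> words n"
      have "map_pmf (\<lambda>u. (tap n S1 (plc c ws u), tap n S2 (dlv c d ws u))) (rnd c)
        = map_pmf (\<lambda>(key, \<phi>, \<psi>). (tap n S1 (\<phi> (cache_label g ws, key)),
             tap n S2 (\<psi> (delivery_label g d ws, masked_label g q d ws key)))) P"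
        unfolding rD[symmetric] map_pmf_comp
        by (simp add: c_def hash_code_def case_prod_unfold)
      also have "pmf \<dots> (tap n S1 y1, tap n S2 y2) \<le>
        (\<Sum>key\<in>grid q. real (card {x \<in> {x \<in> words n. tap n S1 x = tap n S1 y1}. h x = (cache_label g ws, key)}) *
         card {x \<in> {x \<in> words n. tap n S2 x = tap n S2 y2}. k x = (delivery_label g d ws, masked_label g q d ws key)})
         / (card (grid q) * b\<^sup>2)"
        unfolding P_def
      proof (rule pmf_selection_le[OF _ _ _ _ b])
        show "masked_label g q d ws ` grid q \<subseteq> grid q" using mk by blast
      qed (use bins cl dl q in \<open>simp_all add: b_def lessThan_empty_iff\<close>)
      also have "\<dots> \<le> (1 + \<delta>)\<^sup>2 * (2 ^ (n - card S1) * 2 ^ (n - card S2) / ((real g * g)\<^sup>2 * (q * q)))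
         / (card (grid q) * b\<^sup>2)"
        using uniform[OF S y ws d] by (intro divide_right_mono) auto
      also have "\<dots> = (1 + \<delta>)\<^sup>2 * (2 ^ (n - card S1) * 2 ^ (n - card S2)) / ((1 - \<delta>)\<^sup>2 * (2 ^ n * 2 ^ n))"
      proof -
        \<comment> \<open>Here \<open>p\<close> is the square of \<open>g\<close>, \<open>w\<close>
          that of \<open>q\<close>, \<open>e = 1 - \<delta>\<close> and \<open>t = 2 ^ n\<close>:
          the alphabet sizes cancel.\<close>
        have "A * (X / (p\<^sup>2 * w)) / (w * (e * t / (p * w))\<^sup>2) = A * X / (e\<^sup>2 * (t * t))"
          if "p \<noteq> 0" "w \<noteq> 0" "e \<noteq> 0" "t \<noteq> 0" for A X p w e t :: real
          using that by (simp add: power2_eq_square field_simps)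
        from this[where p = "real g * real g" and w = "real q * real q" and e = "1 - \<delta>" and t = "2 ^ n"
            and A = "(1 + \<delta>)\<^sup>2" and X = "2 ^ (n - card S1) * 2 ^ (n - card S2)"] show ?thesis
          using g q \<delta> by (simp add: b_def card_cartesian_product)
      qed
      also have "(2::real) ^ (n - card S1) = 2 ^ n / 2 ^ card S1"
        using cS by (simp add: power_diff)
      also have "(2::real) ^ (n - card S2) = 2 ^ n / 2 ^ card S2"
        using cS by (simp add: power_diff)
      also have "(1 + \<delta>)\<^sup>2 * (2 ^ n / 2 ^ card S1 * (2 ^ n / 2 ^ card S2)) / ((1 - \<delta>)\<^sup>2 * (2 ^ n * 2 ^ n))
        = ((1 + \<delta>) / (1 - \<delta>))\<^sup>2 / 2 ^ (card S1 + card S2)"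
        using \<delta> by (simp add: power_add power_divide)
      finally show "pmf (map_pmf (\<lambda>u. (tap n S1 (plc c ws u), tap n S2 (dlv c d ws u))) (rnd c)) (tap n S1 y1, tap n S2 y2)
        \<le> ((1 + \<delta>) / (1 - \<delta>))\<^sup>2 / 2 ^ (card S1 + card S2)" .
    qed
  qed simp
  ultimately show ?thesis by blast
qed

text \<open>\<open>label_bins\<close> leaves on average at least \<open>r\<close> words per label.
  \<open>secrecy\<close> and \<open>sum_part\<close> are the size conditions of
  \<open>exists_hash_pair\<close> for the subcubes of words consistent with an observation.
  \<open>union_bound\<close> pays for all subcubes, files and demands.\<close>

lemma exists_code_of_params:
  fixes r \<delta> \<alpha> R :: real
  assumes g: "g > 0" and q: "q > 0" and K: "num_msgs n R \<le> g * g * q" and cache: "g * q \<le> cache_size n"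
    and \<alpha>: "\<alpha> \<ge> 0" and \<delta>: "0 < \<delta>" "\<delta> < 1" and r: "r \<ge> 1"
    and label_bins: "r * (real (g * g) * real (q * q)) \<le> 2 ^ n"
    and secrecy: "r\<^sup>2 * (real (g * g))\<^sup>2 * real (q * q) \<le> 2 powr (2 * real n - \<alpha> * n)"
    and sum_part: "g = 1 \<or> r * real (g * g) \<le> 2 powr (real n - \<alpha> * n)"
    and union_bound: "5 * 64 ^ n * exp (- \<delta>\<^sup>2 * r / 4) < 1"
  shows "\<exists>c. valid_code 2 n R c \<and> max_err 2 n R c = 0 \<and>
    max_leak 2 n R \<alpha> c \<le> log 2 (((1 + \<delta>) / (1 - \<delta>))\<^sup>2)"
proof -
  define cube where "cube = (\<lambda>S y. {x \<in> words n. tap n S x = tap n S y})"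
  define \<P> where "\<P> = (\<lambda>((S1, S2), (y1, y2)). (cube S1 y1, cube S2 y2)) ` (tap_sets n \<alpha> \<times> (words n \<times> words n))"
  define \<A> where "\<A> = (\<lambda>(S, y). cube S y) ` (Pow {..<n} \<times> words n)"
  define \<W> where "\<W> = (\<lambda>(ws, d). (cache_label g ws, delivery_label g d ws, masked_label g q d ws)) ` (file_set 2 n R \<times> demands 2)"
  define p where "p = exp (- \<delta>\<^sup>2 * r / 4)"
  have card_cube: "card (cube S y) = 2 ^ (n - card S)" if "S \<subseteq> {..<n}" for S y
    unfolding cube_def by (rule card_tap_fibre[OF that])
  have cg: "card (grid m) = m * m" for m by (simp add: card_cartesian_product)
  have tapsD: "S1 \<subseteq> {..<n}" "S2 \<subseteq> {..<n}" "card S1 \<le> n" "card S2 \<le> n"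
      "real (card S1) + real (card S2) \<le> \<alpha> * n" if "(S1, S2) \<in> tap_sets n \<alpha>" for S1 S2
    using that card_mono[of "{..<n}" S1] card_mono[of "{..<n}" S2] by (auto simp: tap_sets_def)
  have L_le: "real (g * g) * real (q * q) \<le> 2 ^ n"
    using label_bins r mult_right_mono[of 1 r "real (g * g) * real (q * q)"] by simp
  have "real (card \<A>) \<le> real (card (Pow {..<n} \<times> words n))"
    unfolding \<A>_def by (intro of_nat_mono card_image_le) auto
  also have "\<dots> = 4 ^ n"
    by (simp add: card_cartesian_product card_Pow card_words flip: power_mult_distrib)
  finally have cA: "real (card \<A>) \<le> 4 ^ n" .
  have "real (card \<P>) \<le> real (card (tap_sets n \<alpha> \<times> (words n \<times> words n)))"
    unfolding \<P>_def by (intro of_nat_mono card_image_le) (auto simp: finite_tap_sets)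
  also have "\<dots> \<le> real (card ((Pow {..<n} \<times> Pow {..<n}) \<times> (words n \<times> words n)))"
    by (intro of_nat_mono card_mono) (auto simp: tap_sets_def)
  also have "\<dots> = 16 ^ n"
    by (simp add: card_cartesian_product card_Pow card_words flip: power_mult_distrib)
  finally have cP: "real (card \<P>) \<le> 16 ^ n" .
  have "real (num_msgs n R) \<le> real (g * g * q)" using K by (rule of_nat_mono)
  also have "\<dots> \<le> real (g * g) * real (q * q)"
    using q by (simp flip: of_nat_mult)
  also note L_le
  finally have "real (num_msgs n R) \<le> 2 ^ n" .
  then have "real (num_msgs n R) ^ 2 \<le> (2 ^ n) ^ 2" by (intro power_mono) auto
  moreover have "real (card \<W>) \<le> real (card (file_set 2 n R \<times> demands 2))"
    unfolding \<W>_def by (intro of_nat_mono card_image_le) auto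
  moreover have "(2 ^ n) ^ 2 = (4::real) ^ n"
    by (simp add: power2_eq_square flip: power_mult_distrib)
  ultimately have cW: "real (card \<W>) \<le> 4 * 4 ^ n"
    by (simp add: card_cartesian_product card_file_set demands_def)
  \<comment> \<open>The base 64 is 16 times 4: at most \<open>16 ^ n\<close> pairs of subcubes meet
    at most \<open>4 * 4 ^ n\<close> combinations of files and demand. The at most
    \<open>2 ^ n\<close> labels raise the factor from 4 to 5.\<close>
  have p: "p > 0" by (simp add: p_def)
  have pow: "(2::real) ^ n \<le> 64 ^ n" "(4::real) ^ n * 2 ^ n \<le> 64 ^ n" "(16::real) ^ n * 4 ^ n = 64 ^ n" "(0::real) \<le> 64 ^ n"
    by (auto intro!: power_mono simp flip: power_mult_distrib)
  obtain h k where hk: "h \<in> words n \<rightarrow> grid g \<times> grid q" "k \<in> words n \<rightarrow> grid g \<times> grid q"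
    "\<And>l. l \<in> grid g \<times> grid q \<Longrightarrow> (1 - \<delta>) * card (words n) / (card (grid g) * card (grid q)) \<le> card {x \<in> words n. h x = l}"
    "\<And>l. l \<in> grid g \<times> grid q \<Longrightarrow> (1 - \<delta>) * card (words n) / (card (grid g) * card (grid q)) \<le> card {x \<in> words n. k x = l}"
    "\<And>A B c e \<pi>. (A, B) \<in> \<P> \<Longrightarrow> (c, e, \<pi>) \<in> \<W> \<Longrightarrow>
       (\<Sum>q\<in>grid q. real (card {x \<in> A. h x = (c, q)}) * card {x \<in> B. k x = (e, \<pi> q)})
         \<le> (1 + \<delta>)\<^sup>2 * (real (card A) * card B / ((card (grid g))\<^sup>2 * card (grid q)))"
  proof (rule exists_hash_pair[where X = "words n" and C = "grid g" and Q = "grid q" and \<A> = \<A>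
        and \<P> = \<P> and \<W> = \<W> and r = r and \<delta> = \<delta>])
    show "\<P> \<subseteq> \<A> \<times> \<A>"
      by (auto simp: \<P>_def \<A>_def tap_sets_def intro: rev_image_eqI)
    show "finite \<A>" "finite \<W>" by (auto simp: \<A>_def \<W>_def)
    show "A \<subseteq> words n" if "A \<in> \<A>" for A using that by (auto simp: \<A>_def cube_def)
  next
    fix A B assume "(A, B) \<in> \<P>"
    then obtain S1 S2 y1 y2 where S: "(S1, S2) \<in> tap_sets n \<alpha>" and AB: "A = cube S1 y1" "B = cube S2 y2"
      by (auto simp: \<P>_def)
    note t = tapsD[OF S]
    have cAB: "real (card A) = 2 powr (real n - card S1)" "real (card B) = 2 powr (real n - card S2)"
      using t by (simp_all add: AB card_cube powr_realpow[symmetric] of_nat_diff)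
    have "2 powr (2 * real n - \<alpha> * n) \<le> real (card A) * card B"
      unfolding cAB using t by (simp flip: powr_add)
    then show "r\<^sup>2 * (card (grid g))\<^sup>2 * card (grid q) \<le> real (card A) * card B"
      using secrecy by (simp add: cg)
    \<comment> \<open>The product above profits from the budget shared by the two tapping sets; for
      a single subcube, its set may have used up the budget alone.\<close>
    have "2 powr (real n - \<alpha> * n) \<le> card A" "2 powr (real n - \<alpha> * n) \<le> card B"
      unfolding cAB using t by auto
    then show "card (grid g) = 1 \<or> r * card (grid g) \<le> card A \<and> r * card (grid g) \<le> card B"
      using sum_part by (auto simp: cg)
  next
    fix c e \<pi> assume "(c, e, \<pi>) \<in> \<W>"
    then obtain ws d where ws: "ws \<in> file_set 2 n R" and d: "d \<in> demands 2"
      and e: "c = cache_label g ws" "e = delivery_label g d ws" "\<pi> = masked_label g q d ws"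
      by (auto simp: \<W>_def)
    have "ws ! i < g * g * q" if "i < 2" for i
      using ws K that by (auto simp: file_set_def) (metis less_le_trans nth_mem)
    then have p3: "part3 g (ws ! fst d) < q" "part3 g (ws ! snd d) < q"
      using d by (auto simp: demands_def intro!: parts_less(3) g)
    show "c \<in> grid g \<and> e \<in> grid g \<and> inj_on \<pi> (grid q) \<and> \<pi> ` grid q \<subseteq> grid q"
    proof (intro conjI)
      show "inj_on \<pi> (grid q)"
      proof (rule inj_onI)
        fix x y assume x: "x \<in> grid q" and y: "y \<in> grid q" and "\<pi> x = \<pi> y"
        then have "(part3 g (ws ! fst d) + fst x) mod q = (part3 g (ws ! fst d) + fst y) mod q"
          "(part3 g (ws ! snd d) + snd x) mod q = (part3 g (ws ! snd d) + snd y) mod q"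
          by (simp_all add: e masked_label_def case_prod_unfold)
        from inj_onD[OF inj_on_add_mod[OF p3(1)] this(1)] inj_onD[OF inj_on_add_mod[OF p3(2)] this(2)]
        show "x = y" using x y by (auto intro: prod_eqI)
      qed
    qed (use g q in \<open>auto simp: e cache_label_def delivery_label_def masked_label_def parts_less\<close>)
  next
    show "(real (card \<A>) * card (grid g) + real (card \<A>) * (card (grid g) * card (grid q)) + card (grid g) * card (grid q))
       * exp (- \<delta>\<^sup>2 * r / 4) < 1"
    proof -
      have "real (g * g) \<le> real (g * g) * real (q * q)" using q by (simp flip: of_nat_mult)
      then have gg: "real (g * g) \<le> 2 ^ n" using L_le by linarith
      have "real (card \<A>) * card (grid g) \<le> 4 ^ n * 2 ^ n"
        unfolding cg using cA gg by (intro mult_mono) auto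
      moreover have "real (card \<A>) * (card (grid g) * card (grid q)) \<le> 4 ^ n * 2 ^ n"
        unfolding cg using cA L_le by (intro mult_mono) auto
      ultimately have "real (card \<A>) * card (grid g) + real (card \<A>) * (card (grid g) * card (grid q)) + card (grid g) * card (grid q)
          \<le> 5 * 64 ^ n"
        using L_le pow unfolding cg of_nat_mult by linarith
      from mult_right_mono[OF this, of p] p union_bound show ?thesis
        unfolding p_def by linarith
    qed
    show "(real (card \<P>) * card \<W> + card (grid g) * card (grid q)) * exp (- \<delta>\<^sup>2 * r / 4) < 1"
    proof -
      have "real (card \<P>) * card \<W> \<le> 16 ^ n * (4 * 4 ^ n)"
        using cP cW by (intro mult_mono) auto
      then have "real (card \<P>) * card \<W> + card (grid g) * card (grid q) \<le> 5 * 64 ^ n"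
        using L_le pow unfolding cg of_nat_mult by linarith
      from mult_right_mono[OF this, of p] p union_bound show ?thesis
        unfolding p_def by linarith
    qed
    show "r * (card (grid g) * card (grid q)) \<le> card (words n)"
      using label_bins by (simp add: cg card_words)
  qed (use g q \<delta> r in auto)
  show ?thesis
  proof (rule exists_code[OF g q K cache \<alpha> \<delta> hk(1,2)])
    show "(1 - \<delta>) * 2 ^ n / ((g * g) * (q * q)) \<le> card {x \<in> words n. h x = l}"
      "(1 - \<delta>) * 2 ^ n / ((g * g) * (q * q)) \<le> card {x \<in> words n. k x = l}"
      if "l \<in> grid g \<times> grid q" for l
      using hk(3,4)[OF that] by (simp_all add: cg card_words)
  next
    fix S1 S2 y1 y2 ws d
    assume S: "(S1, S2) \<in> tap_sets n \<alpha>" and y: "y1 \<in> words n" "y2 \<in> words n"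
      and ws: "ws \<in> file_set 2 n R" and d: "d \<in> demands 2"
    have P: "(cube S1 y1, cube S2 y2) \<in> \<P>"
      unfolding \<P>_def using S y by (intro rev_image_eqI[where x = "((S1, S2), (y1, y2))"]) auto
    have W: "(cache_label g ws, delivery_label g d ws, masked_label g q d ws) \<in> \<W>"
      unfolding \<W>_def using ws d by (intro rev_image_eqI[where x = "(ws, d)"]) auto
    show "(\<Sum>key\<in>grid q. real (card {x \<in> {x \<in> words n. tap n S1 x = tap n S1 y1}. h x = (cache_label g ws, key)}) *
         card {x \<in> {x \<in> words n. tap n S2 x = tap n S2 y2}. k x = (delivery_label g d ws, masked_label g q d ws key)})
       \<le> (1 + \<delta>)\<^sup>2 * (2 ^ (n - card S1) * 2 ^ (n - card S2) / ((real g * g)\<^sup>2 * (q * q)))"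
      using hk(5)[OF P W] tapsD[OF S] by (simp add: cg card_cube) (simp add: cube_def)
  qed
qed

section \<open>Asymptotics\<close>

text \<open>Memory sharing: a fraction about \<open>1 - \<alpha>\<close> of the block (if positive) is spent on the coded
  caching of parts 1 and 2, of alphabet size \<open>g\<close>, and the rest on one-time pads for part 3.\<close>

lemma exists_sizes:
  fixes \<alpha> R \<eta> :: real
  assumes \<alpha>: "\<alpha> > 0" and R: "R > 0" and \<eta>: "\<eta> = 1 - \<alpha> / 2 - R" "\<eta> > 0" and n: "16 \<le> real n * \<eta>"
  defines "r \<equiv> 2 powr (real n * \<eta> / 2)"
  shows "\<exists>g q. g > 0 \<and> q > 0 \<and> num_msgs n R \<le> g * g * q \<and>
    r * (real (g * g) * real (q * q)) \<le> 2 ^ n \<and>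
    r\<^sup>2 * (real (g * g))\<^sup>2 * real (q * q) \<le> 2 powr (2 * real n - \<alpha> * n) \<and>
    (g = 1 \<or> r * real (g * g) \<le> 2 powr (real n - \<alpha> * n))"
proof -
  define N where "N = real n"
  define K where "K = num_msgs n R"
  have K: "real K \<le> 2 powr (N * R + 1)"
  proof -
    have "(1::real) \<le> 2 powr (N * R)" using R by (simp add: N_def ge_one_powr_ge_zero)
    then show ?thesis using num_msgs_le[of n R] by (simp add: K_def N_def powr_add)
  qed
  have two_n: "(2::real) ^ n = 2 powr N" by (simp add: N_def powr_realpow)
  have r: "r = 2 powr (N * \<eta> / 2)" by (simp add: r_def N_def)
  have n': "16 \<le> N * \<eta>" using n by (simp add: N_def)
  have N: "N \<ge> 0" by (simp add: N_def)
  have sq: "real (m * m) \<le> 2 powr (2 * a)" if "real m \<le> 2 powr a" for m and a :: real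
  proof -
    have "real m * real m \<le> 2 powr a * 2 powr a" using that by (intro mult_mono) auto
    then show ?thesis by (simp flip: powr_add)
  qed
  have *: "\<exists>g q. g > 0 \<and> q > 0 \<and> K \<le> g * g * q \<and> real (g * g) \<le> 2 powr a \<and> real (q * q) \<le> 2 powr b \<and>
     a + b \<le> N - N * \<eta> / 2 \<and> 2 * a + b \<le> 2 * N - \<alpha> * N - N * \<eta> \<and> (g = 1 \<or> a \<le> N - \<alpha> * N - N * \<eta> / 2) \<Longrightarrow> ?thesis"
    for a b
  proof -
    assume "\<exists>g q. g > 0 \<and> q > 0 \<and> K \<le> g * g * q \<and> real (g * g) \<le> 2 powr a \<and> real (q * q) \<le> 2 powr b \<and>
     a + b \<le> N - N * \<eta> / 2 \<and> 2 * a + b \<le> 2 * N - \<alpha> * N - N * \<eta> \<and> (g = 1 \<or> a \<le> N - \<alpha> * N - N * \<eta> / 2)"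
    then obtain g q where gq: "g > 0" "q > 0" "K \<le> g * g * q" "real (g * g) \<le> 2 powr a" "real (q * q) \<le> 2 powr b"
     and ab: "a + b \<le> N - N * \<eta> / 2" "2 * a + b \<le> 2 * N - \<alpha> * N - N * \<eta>" "g = 1 \<or> a \<le> N - \<alpha> * N - N * \<eta> / 2"
      by auto
    have "r * (real (g * g) * real (q * q)) \<le> 2 powr (N * \<eta> / 2) * (2 powr a * 2 powr b)"
      unfolding r using gq by (intro mult_mono) auto
    also have "\<dots> = 2 powr (N * \<eta> / 2 + (a + b))" by (simp only: powr_add)
    also have "\<dots> \<le> 2 ^ n" unfolding two_n using ab by (intro powr_mono) auto
    finally have 1: "r * (real (g * g) * real (q * q)) \<le> 2 ^ n" .
    have "r\<^sup>2 * (real (g * g))\<^sup>2 * real (q * q) \<le> (2 powr (N * \<eta> / 2))\<^sup>2 * (2 powr a)\<^sup>2 * 2 powr b"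
      unfolding r using gq by (intro mult_mono power_mono) auto
    also have "\<dots> = 2 powr ((N * \<eta> / 2 + N * \<eta> / 2) + (a + a) + b)" by (simp only: powr_add power2_eq_square)
    also have "\<dots> \<le> 2 powr (2 * N - \<alpha> * N)" using ab by (intro powr_mono) auto
    finally have 2: "r\<^sup>2 * (real (g * g))\<^sup>2 * real (q * q) \<le> 2 powr (2 * N - \<alpha> * N)" .
    have 3: "g = 1 \<or> r * real (g * g) \<le> 2 powr (N - \<alpha> * N)"
    proof (cases "g = 1")
      case False
      have "r * real (g * g) \<le> 2 powr (N * \<eta> / 2) * 2 powr a"
        unfolding r using gq by (intro mult_mono) auto
      also have "\<dots> = 2 powr (N * \<eta> / 2 + a)" by (simp only: powr_add)
      also have "\<dots> \<le> 2 powr (N - \<alpha> * N)" using ab False by (intro powr_mono) auto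
      finally show ?thesis by simp
    qed simp
    show ?thesis
      using gq(1-3) 1 2 3 unfolding K_def N_def by blast
  qed
  show ?thesis
  proof (cases "R \<le> \<alpha> / 2")
    \<comment> \<open>At rates up to \<open>\<alpha> / 2\<close> one-time pads suffice:
      \<open>g = 1\<close>, and the key alphabet is the whole file alphabet.\<close>
    case True
    have "real (K * K) \<le> 2 powr (2 * (N * R + 1))" by (rule sq[OF K])
    moreover have "0 + 2 * (N * R + 1) \<le> N - N * \<eta> / 2"
    proof -
      have "N * (2 * R) \<le> N * (1 - \<eta>)" using True N \<eta>(1) by (intro mult_left_mono) auto
      then show ?thesis using n' by (simp add: algebra_simps)
    qed
    moreover have "2 * 0 + 2 * (N * R + 1) \<le> 2 * N - \<alpha> * N - N * \<eta>"
      using n' unfolding \<eta>(1) by (simp add: algebra_simps)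
    ultimately show ?thesis
      by (intro *[of 0 "2 * (N * R + 1)"] exI[of _ 1] exI[of _ K]) (auto simp: K_def)
  next
    case False
    \<comment> \<open>Chosen so that \<open>2 * \<theta> + \<alpha> / 2 = R\<close>: parts 1 and 2
      carry rate \<theta> each and the padded part 3 carries \<open>\<alpha> / 2\<close>.\<close>
    define \<theta> where "\<theta> = (R - \<alpha> / 2) / 2"
    define g where "g = nat \<lceil>2 powr (N * \<theta>)\<rceil>"
    define q where "q = nat \<lceil>real K / real (g * g)\<rceil>"
    have \<theta>: "\<theta> > 0" using False by (simp add: \<theta>_def)
    have g_ge: "2 powr (N * \<theta>) \<le> real g"
      unfolding g_def by linarith
    have one: "(1::real) \<le> 2 powr (N * \<theta>)" using \<theta> N by (simp add: ge_one_powr_ge_zero)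
    then have "real g \<le> 2 powr (N * \<theta>) + 2 powr (N * \<theta>)"
      unfolding g_def by linarith
    then have g_le: "real g \<le> 2 powr (N * \<theta> + 1)" by (simp add: powr_add)
    have g: "g > 0" using g_ge one by linarith
    have K_pos: "K > 0" by (simp add: K_def)
    have q: "q > 0" using g K_pos by (simp add: q_def)
    have "real K / real (g * g) \<le> real q" unfolding q_def by linarith
    then have "real K \<le> real (g * g * q)" using g by (simp add: field_simps)
    then have Kgq: "K \<le> g * g * q" by linarith
    have "(2 powr (N * \<theta>)) * (2 powr (N * \<theta>)) \<le> real g * real g"
      using g_ge by (intro mult_mono) auto
    then have gg: "2 powr (N * \<theta> + N * \<theta>) \<le> real (g * g)" by (simp only: powr_add of_nat_mult)
    have "real K / real (g * g) \<le> 2 powr (N * R + 1) / 2 powr (N * \<theta> + N * \<theta>)"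
      using K gg by (intro frac_le) auto
    also have "\<dots> = 2 powr (N * \<alpha> / 2 + 1)"
      unfolding powr_diff[symmetric] by (simp add: \<theta>_def algebra_simps)
    finally have "real K / real (g * g) \<le> 2 powr (N * \<alpha> / 2 + 1)" .
    moreover have "(1::real) \<le> 2 powr (N * \<alpha> / 2 + 1)"
      using N \<alpha> by (simp add: ge_one_powr_ge_zero)
    ultimately have "real q \<le> 2 powr (N * \<alpha> / 2 + 1) + 2 powr (N * \<alpha> / 2 + 1)"
      unfolding q_def by linarith
    then have q_le: "real q \<le> 2 powr (N * \<alpha> / 2 + 1 + 1)" by (simp add: powr_add)
    have gg_le: "real (g * g) \<le> 2 powr (2 * (N * \<theta> + 1))" by (rule sq[OF g_le])
    have qq_le: "real (q * q) \<le> 2 powr (2 * (N * \<alpha> / 2 + 1 + 1))" by (rule sq[OF q_le])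
    have "2 * (N * \<theta> + 1) + 2 * (N * \<alpha> / 2 + 1 + 1) \<le> N - N * \<eta> / 2"
      "2 * (2 * (N * \<theta> + 1)) + 2 * (N * \<alpha> / 2 + 1 + 1) \<le> 2 * N - \<alpha> * N - N * \<eta>"
      "2 * (N * \<theta> + 1) \<le> N - \<alpha> * N - N * \<eta> / 2"
    proof -
      \<comment> \<open>Here \<open>a\<close>, \<open>u\<close>, \<open>t\<close>, \<open>e\<close>
        stand for \<open>N\<close> times \<alpha>, \<open>R\<close>, \<theta>, \<eta>. The additive
        constants collect the rounding of \<open>K\<close>, \<open>g\<close> and \<open>q\<close>,
        and \<open>16 \<le> e\<close> absorbs them.\<close>
      have arith: "2 * (t + 1) + 2 * (a / 2 + 1 + 1) \<le> N - e / 2"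
          "2 * (2 * (t + 1)) + 2 * (a / 2 + 1 + 1) \<le> 2 * N - a - e" "2 * (t + 1) \<le> N - a - e / 2"
        if "e = N - a / 2 - u" "t = u / 2 - a / 4" "16 \<le> e" for a e t u :: real
      proof -
        have "u = N - a / 2 - e" "t = N / 2 - a / 2 - e / 2" using that by (auto simp: field_simps)
        then show "2 * (t + 1) + 2 * (a / 2 + 1 + 1) \<le> N - e / 2"
          "2 * (2 * (t + 1)) + 2 * (a / 2 + 1 + 1) \<le> 2 * N - a - e" "2 * (t + 1) \<le> N - a - e / 2"
          using that(3) by (auto simp: field_simps)
      qed
      have "N * \<eta> = N - N * \<alpha> / 2 - N * R" "N * \<theta> = N * R / 2 - N * \<alpha> / 4"
        by (simp_all add: \<eta>(1) \<theta>_def field_simps)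
      from arith[OF this n'] show "2 * (N * \<theta> + 1) + 2 * (N * \<alpha> / 2 + 1 + 1) \<le> N - N * \<eta> / 2"
        "2 * (2 * (N * \<theta> + 1)) + 2 * (N * \<alpha> / 2 + 1 + 1) \<le> 2 * N - \<alpha> * N - N * \<eta>"
        "2 * (N * \<theta> + 1) \<le> N - \<alpha> * N - N * \<eta> / 2"
        by (simp_all only: mult.commute[of \<alpha> N])
    qed
    then show ?thesis
      using g q Kgq gg_le qq_le
      by (intro *[of "2 * (N * \<theta> + 1)" "2 * (N * \<alpha> / 2 + 1 + 1)"] exI[of _ g] exI[of _ q]) auto
  qed
qed

section \<open>Rate zero and the limit of the codes\<close>

definition silent_code :: "nat \<Rightarrow> cbc_code" where
  "silent_code n = \<lparr> rnd = return_pmf 0, plc = (\<lambda>ws u. replicate n False), cch = (\<lambda>j x. 0),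
     dlv = (\<lambda>d ws u. replicate n False), dec = (\<lambda>d j m y. 0) \<rparr>"

lemma cache_size_pos: "cache_size n > 0"
proof -
  have "(1::real) \<le> 2 powr (real n / 2)" by (simp add: ge_one_powr_ge_zero)
  then show ?thesis unfolding cache_size_def by linarith
qed

lemma valid_silent_code: "valid_code D n R (silent_code n)"
  by (simp add: valid_code_def silent_code_def cache_size_pos)

text \<open>At rate 0 each file has the single value 0, which the silent code always outputs, and
  its constant transmission reveals nothing. This rate attains the capacity at
  \<open>\<alpha> = 2\<close>.\<close>

lemma achievable_0:
  assumes "\<alpha> \<ge> 0"
  shows "achievable 2 \<alpha> 0"
proof -
  have "max_err 2 n 0 (silent_code n) = 0" for n
  proof (rule max_err_eq_0)
    fix d ws u assume d: "d \<in> demands 2" and ws: "ws \<in> file_set 2 n 0"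
    then have "ws ! i = 0" if "i < 2" for i
      using that nth_mem[of i ws] by (fastforce simp: file_set_def num_msgs_def)
    then show "dec (silent_code n) d 0 (cch (silent_code n) 0 (plc (silent_code n) ws u)) (dlv (silent_code n) d ws u) = ws ! fst d \<and>
      dec (silent_code n) d 1 (cch (silent_code n) 1 (plc (silent_code n) ws u)) (dlv (silent_code n) d ws u) = ws ! snd d"
      using d by (auto simp: silent_code_def demands_def)
  qed simp
  moreover have "max_leak 2 n 0 \<alpha> (silent_code n) = 0" for n
  proof (rule antisym[OF max_leak_le max_leak_nonneg])
    fix d S1 S2
    let ?c = "silent_code n"
    let ?Y = "taps n ?c d S1 S2"
    let ?z = "(tap n S1 (replicate n False), tap n S2 (replicate n False))"
    have "leakage 2 n 0 ?c d S1 S2 \<le> log 2 1"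
      unfolding leakage_eq_taps
    proof (rule mutual_information_pmf_le[OF finite_leakage_support, where B = "{?z}"])
      show "set_pmf (map_pmf ?Y (joint 2 n 0 ?c)) \<subseteq> {?z}"
        by (auto simp: taps_def silent_code_def)
      show "pmf (map_pmf (\<lambda>a. (fst a, ?Y a)) (joint 2 n 0 ?c)) (x, y)
         \<le> 1 / real (card {?z}) * pmf (map_pmf fst (joint 2 n 0 ?c)) x" for x y
        by (auto simp: pmf_map intro!: measure_pmf.finite_measure_mono)
    qed auto
    then show "leakage 2 n 0 ?c d S1 S2 \<le> 0" by simp
  qed (use assms in auto)
  ultimately show ?thesis
    unfolding achievable_def
    by (intro exI[of _ silent_code]) (simp add: valid_silent_code)
qed

lemma achievable_below:
  assumes \<alpha>: "0 < \<alpha>" and R: "0 < R" "R < 1 - \<alpha> / 2"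
  shows "achievable 2 \<alpha> R"
proof -
  define \<eta> where "\<eta> = 1 - \<alpha> / 2 - R"
  have \<eta>: "\<eta> > 0" using R by (simp add: \<eta>_def)
  define r where "r = (\<lambda>n. 2 powr (real n * \<eta> / 2))"
  \<comment> \<open>This is \<open>r\<close> to the power \<open>- 1 / 4\<close>: it tends to 0,
    while \<open>\<delta>\<^sup>2 * r\<close> still grows exponentially, so that
    \<open>exp (- \<delta>\<^sup>2 * r / 4)\<close> beats \<open>64 ^ n\<close>.\<close>
  define \<delta> where "\<delta> = (\<lambda>n. 2 powr (- (real n * \<eta> / 8)))"
  define good where "good = (\<lambda>n c. valid_code 2 n R c \<and> max_err 2 n R c = 0 \<and>
    max_leak 2 n R \<alpha> c \<le> log 2 (((1 + \<delta> n) / (1 - \<delta> n))\<^sup>2))"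
  have "\<forall>\<^sub>F n in sequentially. 16 \<le> real n * \<eta>"
    using \<eta> by real_asymp
  moreover have "\<forall>\<^sub>F n in sequentially. 5 * 64 ^ n * exp (- (2 powr (real n * \<eta> / 4)) / 4) < 1"
    using \<eta> by real_asymp
  ultimately have ev: "\<forall>\<^sub>F n in sequentially. \<exists>c. good n c"
  proof eventually_elim
    case (elim n)
    have "\<exists>g q. g > 0 \<and> q > 0 \<and> num_msgs n R \<le> g * g * q \<and>
      r n * (real (g * g) * real (q * q)) \<le> 2 ^ n \<and>
      (r n)\<^sup>2 * (real (g * g))\<^sup>2 * real (q * q) \<le> 2 powr (2 * real n - \<alpha> * n) \<and>
      (g = 1 \<or> r n * real (g * g) \<le> 2 powr (real n - \<alpha> * n))"
      unfolding r_def by (rule exists_sizes[OF \<alpha> R(1) \<eta>_def \<eta> elim(1)])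
    then obtain g q where gq: "g > 0" "q > 0" "num_msgs n R \<le> g * g * q"
      "r n * (real (g * g) * real (q * q)) \<le> 2 ^ n"
      "(r n)\<^sup>2 * (real (g * g))\<^sup>2 * real (q * q) \<le> 2 powr (2 * real n - \<alpha> * n)"
      "g = 1 \<or> r n * real (g * g) \<le> 2 powr (real n - \<alpha> * n)"
      by (elim exE conjE) (rule that)
    have r1: "r n \<ge> 1" using \<eta> by (simp add: r_def ge_one_powr_ge_zero)
    have d: "0 < \<delta> n" "\<delta> n < 1" using elim(1) by (auto simp: \<delta>_def powr_less_one)
    have "(\<delta> n)\<^sup>2 * r n = 2 powr (- (real n * \<eta> / 8) + - (real n * \<eta> / 8) + real n * \<eta> / 2)"
      unfolding \<delta>_def r_def power2_eq_square by (simp only: powr_add)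
    also have "\<dots> = 2 powr (real n * \<eta> / 4)" by (simp add: mult.commute)
    finally have "5 * 64 ^ n * exp (- (\<delta> n)\<^sup>2 * r n / 4) < 1"
      using elim(2) by simp
    moreover have "g * q \<le> cache_size n"
    proof -
      \<comment> \<open>The cache constraint follows from the condition on label bins, because
        \<open>r\<close> is at least 1.\<close>
      have "(real (g * q))\<^sup>2 \<le> 2 ^ n"
        using gq(4) mult_right_mono[OF r1, of "real (g * g) * real (q * q)"]
        by (simp add: power2_eq_square mult_ac)
      also have "\<dots> = (2 powr (real n / 2))\<^sup>2"
        unfolding power2_eq_square powr_add[symmetric] by (simp add: powr_realpow)
      finally have "real (g * q) \<le> 2 powr (real n / 2)"
        by (rule power2_le_imp_le) simp
      then show ?thesis unfolding cache_size_def by (rule le_nat_floor)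
    qed
    ultimately show ?case
      unfolding good_def using exists_code_of_params[OF gq(1-3) _ _ d r1 gq(4-6)] \<alpha> by auto
  qed
  \<comment> \<open>Validity is required at every \<open>n\<close>, so the silent code fills the
    block lengths that have no good code.\<close>
  define codes where "codes = (\<lambda>n. if \<exists>c. good n c then SOME c. good n c else silent_code n)"
  have codes_good: "\<forall>\<^sub>F n in sequentially. good n (codes n)"
    using ev by eventually_elim (auto simp: codes_def intro: someI_ex)
  have "valid_code 2 n R (codes n)" for n
    using someI_ex[of "good n"] valid_silent_code by (auto simp: codes_def good_def)
  moreover have "(\<lambda>n. max_err 2 n R (codes n)) \<longlonglongrightarrow> 0"
    by (rule tendsto_eventually) (use codes_good in eventually_elim, simp add: good_def)
  moreover have "(\<lambda>n. max_leak 2 n R \<alpha> (codes n)) \<longlonglongrightarrow> 0"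
  proof (rule tendsto_sandwich)
    show "\<forall>\<^sub>F n in sequentially. 0 \<le> max_leak 2 n R \<alpha> (codes n)"
      using \<alpha> by (intro always_eventually allI max_leak_nonneg) auto
    show "\<forall>\<^sub>F n in sequentially. max_leak 2 n R \<alpha> (codes n) \<le> log 2 (((1 + \<delta> n) / (1 - \<delta> n))\<^sup>2)"
      using codes_good by eventually_elim (simp add: good_def)
    have "\<delta> \<longlonglongrightarrow> 0" unfolding \<delta>_def using \<eta> by real_asymp
    then have "(\<lambda>n. log 2 (((1 + \<delta> n) / (1 - \<delta> n))\<^sup>2)) \<longlonglongrightarrow> log 2 (((1 + 0) / (1 - 0))\<^sup>2)"
      by (intro tendsto_intros) auto
    then show "(\<lambda>n. log 2 (((1 + \<delta> n) / (1 - \<delta> n))\<^sup>2)) \<longlonglongrightarrow> 0" by simp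
  qed simp
  ultimately show ?thesis unfolding achievable_def by blast
qed

theorem theorem1:
  fixes \<alpha> :: real
  assumes "0 < \<alpha>" and "\<alpha> \<le> 2"
  shows "secrecy_capacity 2 \<alpha> = 1 - \<alpha> / 2"
  unfolding secrecy_capacity_def
proof (rule cSup_eq)
  show "R \<le> 1 - \<alpha> / 2" if "R \<in> {R. achievable 2 \<alpha> R}" for R
    using achievable_imp_le[OF assms] that by simp
  show "1 - \<alpha> / 2 \<le> y" if y: "\<And>R. R \<in> {R. achievable 2 \<alpha> R} \<Longrightarrow> R \<le> y" for y
  proof (cases "\<alpha> = 2")
    \<comment> \<open>The claim is \<open>0 \<le> y\<close>, which the rate 0 supplies.\<close>
    case True
    then show ?thesis using y[of 0] achievable_0[of \<alpha>] by simp
  next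
    case False
    \<comment> \<open>Every rate strictly between 0 and this value is achievable, so density of the
      reals gives the bound.\<close>
    then have "0 < 1 - \<alpha> / 2" using assms by simp
    then show ?thesis
      by (rule dense_le_bounded) (use y achievable_below[OF assms(1)] in auto)
  qed
qed

end
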